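(* Let $\rho^{\delta,\pm}(r,t)$ be the deterministic upper ($+$) and lower ($-$) barriers with initial datum $\rho_0$, defined in the context. For any $\delta>0$ and any $t=k\delta$, $k$ a positive integer: $$\rho^{\delta,-}(r,t)dr\preccurlyeq\rho^{\delta,+}(r,t)dr,$$ $$\rho^{\delta,-}(r,t)dr\preccurlyeq\rho^{\delta/2,-}(r,t)dr,\qquad \rho^{\delta/2,+}(r,t)dr\preccurlyeq\rho^{\delta,+}(r,t)dr,$$ and there is a unique function $u(r,t)$ such that $$\rho^{\delta,-}(r,t)dr\preccurlyeq u(r,t)dr\preccurlyeq\rho^{\delta,+}(r,t)dr\qquad\text{for all }\delta>0\text{ and } t=k\delta,\ k \text{ a positive integer}.$$ Moreover the barriers are close in $L^1$: there is a constant $c$ such that, if $\delta=2^{-n}T$ ($T>0$, $n\in\mathbb N$), then $$\int dr\,\big|\rho^{\delta,-}(r,2^n\delta)-\rho^{\delta,+}(r,2^n\delta)\big|\le c\,e^T\delta .$$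
   Context: Standing assumptions. $\rho_0$ is a $C^\infty$ probability density on $\mathbb R$ with support in $[-A,A]$, $A>0$. $p(x,y)=p(0,y-x)$ is a translation invariant probability density in $y$; $p(0,\cdot)$ is $C^\infty$ and $p(0,x)=0$ for $|x|\ge\xi$, where $\xi>0$. Order: for finite positive measures $\mu,\nu$ on $\mathbb R$, $\mu\preccurlyeq\nu$ means $\mu([r,\infty))\le\nu([r,\infty))$ for all $r\in\mathbb R$. Free evolution: $T^*_tf(x)=e^t\,E^*_x[f(X^*_t)]$, where $X^*_t$ is the Markov process which is a Brownian motion on $\mathbb R$ with in addition jumps at rate 1, a jump from $x$ going to $y$ with probability density $p^*(x,y)=p(y,x)$; equivalently $\rho(\cdot,t)=T^*_t f$ solves $\partial_t\rho(y,t)=\frac12\partial_y^2\rho(y,t)+\int dz\,\rho(z,t)p(z,y)$ with initial datum $f$. Cut operators: let $\mathcal M_a$ be the set of $v\in L^1(\mathbb R,\mathbb R_+)$ with $\int v=a$. $C^+_\delta:\mathcal M_{e^\delta}\to\mathcal M_1$, $C^+_\delta v(x)=\mathbf 1_{x\ge V^+}v(x)$ with $V^+$ such that $\int_{V^+}^\infty v=1$. $C^-_\delta:\mathcal M_1\to\mathcal M_{e^{-\delta}}$, $C^-_\delta v(x)=\mathbf 1_{x\ge V^-}v(x)$ with $V^-$ such that $\int_{V^-}^\infty v=e^{-\delta}$. Barriers: for integer $k>0$, $\rho^{\delta,-}(x,k\delta)=(T^*_\delta C^-_\delta)^k\rho_0(x)$ and $\rho^{\delta,+}(x,k\delta)=(C^+_\delta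 T^*_\delta)^k\rho_0(x)$. Uniqueness of $u(\cdot,t)$ is for $t>0$, as a density (i.e. up to Lebesgue-null sets). *)

theory Defs
  imports "HOL-Probability.Probability"
begin

definition smooth :: "(real \<Rightarrow> real) \<Rightarrow> bool" where
  "smooth f \<longleftrightarrow> (\<forall>n x. (deriv ^^ n) f field_differentiable at x)"

text \<open>
  The functions \<open>v \<in> L\<^sup>1(\<real>, \<real>\<^sub>+)\<close> of total mass \<open>a\<close>, as actual functions;
  the elements of \<open>mass_functions 1\<close> are the probability densities.
\<close>

definition mass_functions :: "real \<Rightarrow> (real \<Rightarrow> real) set" where
  "mass_functions a =
     {v. integrable lborel v \<and> (\<forall>x. 0 \<le> v x) \<and> (LINT x|lborel. v x) = a}"

text \<open>The measure \<open>f(r) dr\<close>.\<close>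

definition dens :: "(real \<Rightarrow> real) \<Rightarrow> real measure" where
  "dens f = density lborel (\<lambda>r. ennreal (f r))"

definition tail_le :: "real measure \<Rightarrow> real measure \<Rightarrow> bool"  (infix \<open>\<preceq>\<close> 50) where
  "\<mu> \<preceq> \<nu> \<longleftrightarrow> (\<forall>r. emeasure \<mu> {r..} \<le> emeasure \<nu> {r..})"

text \<open>
  The process \<open>X\<^sup>*\<close> is a Brownian motion with additional jumps at rate 1, a jump from \<open>x\<close>
  leading to \<open>y\<close> with density \<open>p\<^sup>*(x,y) = p(y,x)\<close>.  By translation invariance the jump
  displacements are independent of the position and have density \<open>p\<^sup>*(0,\<cdot>)\<close>, so for \<open>t > 0\<close>
  the process started at \<open>x\<close> is at time \<open>t\<close> at \<open>x + b + (\<Sum>i<n. j i)\<close>, where \<open>b\<close> is the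
  Brownian displacement (centred normal, variance \<open>t\<close>), \<open>n\<close> the number of jumps up to
  time \<open>t\<close> (Poisson, mean \<open>t\<close>) and \<open>j\<close> the i.i.d. sequence of jump displacements, all three
  independent.  \<open>noise p t\<close> is the joint law of \<open>(b, n, j)\<close>; since \<open>T\<^sup>*\<^sub>t\<close> involves the
  process at the single time \<open>t\<close> only, no path space is needed.
\<close>

definition pstar :: "(real \<Rightarrow> real \<Rightarrow> real) \<Rightarrow> real \<Rightarrow> real \<Rightarrow> real" where
  "pstar p x y = p y x"

definition noise ::
  "(real \<Rightarrow> real \<Rightarrow> real) \<Rightarrow> real \<Rightarrow> (real \<times> nat \<times> (nat \<Rightarrow> real)) measure" where
  "noise p t =
     dens (normal_density 0 (sqrt t)) \<Otimes>\<^sub>M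
       (measure_pmf (poisson_pmf t) \<Otimes>\<^sub>M (\<Pi>\<^sub>M i\<in>(UNIV::nat set). dens (pstar p 0)))"

definition Xstar :: "real \<Rightarrow> real \<times> nat \<times> (nat \<Rightarrow> real) \<Rightarrow> real" where
  "Xstar x = (\<lambda>(b, n, j). x + b + (\<Sum>i<n. j i))"

definition Tstar ::
  "(real \<Rightarrow> real \<Rightarrow> real) \<Rightarrow> real \<Rightarrow> (real \<Rightarrow> real) \<Rightarrow> real \<Rightarrow> real" where
  "Tstar p t f x = exp t * (LINT \<omega>|noise p t. f (Xstar x \<omega>))"

text \<open>
  \<open>cut_point m v\<close> need not be unique when \<open>v\<close> vanishes on an interval, but \<open>cut m v\<close> is then
  still determined up to a null set.  The two cut operators differ in their domains
  (mass \<open>exp \<delta>\<close> for \<open>Cplus\<close>, mass 1 for \<open>Cminus\<close>) and in the mass retained; the formula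
  for \<open>Cplus\<close> does not mention \<open>\<delta>\<close>.
\<close>

definition cut_point :: "real \<Rightarrow> (real \<Rightarrow> real) \<Rightarrow> real" where
  "cut_point m v = (SOME V. (LINT x:{V..}|lborel. v x) = m)"

definition cut :: "real \<Rightarrow> (real \<Rightarrow> real) \<Rightarrow> real \<Rightarrow> real" where
  "cut m v x = indicator {cut_point m v..} x * v x"

definition Cplus :: "real \<Rightarrow> (real \<Rightarrow> real) \<Rightarrow> real \<Rightarrow> real" where
  "Cplus \<delta> = cut 1"

definition Cminus :: "real \<Rightarrow> (real \<Rightarrow> real) \<Rightarrow> real \<Rightarrow> real" where
  "Cminus \<delta> = cut (exp (- \<delta>))"

text \<open>The barriers at time \<open>k\<delta>\<close> are indexed by the integer \<open>k\<close>.\<close>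

definition lower_barrier ::
  "(real \<Rightarrow> real \<Rightarrow> real) \<Rightarrow> (real \<Rightarrow> real) \<Rightarrow> real \<Rightarrow> nat \<Rightarrow> real \<Rightarrow> real" where
  "lower_barrier p \<rho>0 \<delta> k = ((Tstar p \<delta> \<circ> Cminus \<delta>) ^^ k) \<rho>0"

definition upper_barrier ::
  "(real \<Rightarrow> real \<Rightarrow> real) \<Rightarrow> (real \<Rightarrow> real) \<Rightarrow> real \<Rightarrow> nat \<Rightarrow> real \<Rightarrow> real" where
  "upper_barrier p \<rho>0 \<delta> k = ((Cplus \<delta> \<circ> Tstar p \<delta>) ^^ k) \<rho>0"

text \<open>\<open>u(r,t) dr\<close> is, for \<open>t > 0\<close>, a finite positive measure lying between all barriers.\<close>

definition between_barriers ::
  "(real \<Rightarrow> real \<Rightarrow> real) \<Rightarrow> (real \<Rightarrow> real) \<Rightarrow> (real \<Rightarrow> real \<Rightarrow> real) \<Rightarrow> bool" where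
  "between_barriers p \<rho>0 u \<longleftrightarrow>
     (\<forall>t>0. integrable lborel (\<lambda>r. u r t) \<and> (\<forall>r. 0 \<le> u r t)) \<and>
     (\<forall>\<delta>>0. \<forall>k>0.
        dens (lower_barrier p \<rho>0 \<delta> k) \<preceq> dens (\<lambda>r. u r (real k * \<delta>)) \<and>
        dens (\<lambda>r. u r (real k * \<delta>)) \<preceq> dens (upper_barrier p \<rho>0 \<delta> k))"

end

theory Submission
  imports Defs
begin

text \<open>
  Everything is read off the tail function \<open>F(r) = \<integral>\<^sub>r\<^sup>\<infinity> f\<close>: the free evolution acts on it as
  \<open>exp t\<close> times the convolution with the law of the displacement, a monotone operator that forms a
  semigroup (by comparison of characteristic functions), and a cut at mass \<open>m\<close> is
  \<open>F \<mapsto> min m F\<close>.  All the tail inequalities, including refinement of the time step by an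
  arbitrary integer, follow from monotonicity and the action on constants.

  For the \<open>L\<^sup>1\<close> bound, a cut is an \<open>L\<^sup>1\<close> contraction on functions of equal mass.  The rescaled lower
  barrier \<open>w\<^sub>k = exp \<delta> * Cminus \<delta> (lower\<^sub>k)\<close> satisfies the recursion of the upper barrier and is
  \<open>2\<delta>\<close>-close to the lower one, so the initial error \<open>2\<delta>\<close> is multiplied by at most
  \<open>exp \<delta>\<close> per step.

  The supremum of the lower tails at time \<open>t\<close> is Lipschitz, because the lower barriers are bounded by
  \<open>exp t * sup \<rho>0\<close>; hence it is the tail of a density \<open>u(\<cdot>, t)\<close>, by Radon--Nikodym.  Uniqueness is the
  squeeze between the barriers as \<open>\<delta> = t / 2 ^ n \<rightarrow> 0\<close>.
\<close>

section \<open>The law of the displacement\<close>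

lemma (in real_distribution) char_add_distr:
  assumes "real_distribution N"
  shows "char (distr (M \<Otimes>\<^sub>M N) borel (\<lambda>(x, y). x + y)) s = char M s * char N s"
proof -
  interpret N: real_distribution N by fact
  interpret pair_prob_space M N ..
  have "char (distr (M \<Otimes>\<^sub>M N) borel (\<lambda>(x, y). x + y)) s
      = (CLINT z|M \<Otimes>\<^sub>M N. iexp (s * (fst z + snd z)))"
    unfolding char_def by (subst integral_distr) (auto simp: case_prod_beta)
  also have "\<dots> = (CLINT x|M. CLINT y|N. iexp (s * (x + y)))"
    by (subst integral_fst'[symmetric]) (auto intro!: P.integrable_const_bound[where B=1] AE_I2)
  also have "\<dots> = (CLINT x|M. CLINT y|N. iexp (s * x) * iexp (s * y))"
    by (simp add: exp_add distrib_left)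
  also have "\<dots> = char M s * char N s"
    unfolding char_def by simp
  finally show ?thesis .
qed

text \<open>This is the generating function of the Poisson law on the closed unit disc, where the
  powers of \<open>z\<close> stay bounded and hence integrable. Its argument will be the
  characteristic function of a single jump.\<close>

lemma integral_poisson_pmf_power:
  fixes z :: complex
  assumes "t > 0" "norm z \<le> 1"
  shows "(LINT n|measure_pmf (poisson_pmf t). z ^ n) = exp (of_real t * z - of_real t)"
proof -
  have sums: "(\<lambda>n. (of_real t * z) ^ n /\<^sub>R fact n) sums exp (of_real t * z)"
    by (rule exp_converges)
  have i: "integrable (measure_pmf (poisson_pmf t)) (\<lambda>n. z ^ n)"
    by (rule measure_pmf.integrable_const_bound[where B=1])
      (use assms in \<open>auto simp: norm_power intro!: AE_I2 power_le_one\<close>)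
  have m: "measure_pmf (poisson_pmf t) = density (count_space UNIV) (pmf (poisson_pmf t))"
    by (rule measure_pmf_eq_density)
  have i2: "integrable (count_space UNIV) (\<lambda>n. pmf (poisson_pmf t) n *\<^sub>R z ^ n)"
    using i unfolding m by (subst (asm) integrable_density) auto
  have "(LINT n|measure_pmf (poisson_pmf t). z ^ n)
      = (LINT n|count_space UNIV. pmf (poisson_pmf t) n *\<^sub>R z ^ n)"
    unfolding m by (subst integral_density) auto
  moreover have "(\<lambda>n. pmf (poisson_pmf t) n *\<^sub>R z ^ n) sums
      (LINT n|count_space UNIV. pmf (poisson_pmf t) n *\<^sub>R z ^ n)"
    by (rule sums_integral_count_space_nat[OF i2])
  moreover have "(\<lambda>n. pmf (poisson_pmf t) n *\<^sub>R z ^ n) =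
      (\<lambda>n. exp (- of_real t) * ((of_real t * z) ^ n /\<^sub>R fact n))"
    using assms by (auto simp: fun_eq_iff scaleR_conv_of_real power_mult_distrib field_simps
        exp_of_real[symmetric])
  moreover have "(\<lambda>n. exp (- of_real t) * ((of_real t * z) ^ n /\<^sub>R fact n)) sums
      (exp (- of_real t) * exp (of_real t * z))"
    by (intro sums_mult sums)
  ultimately show ?thesis
    by (simp add: sums_iff exp_diff exp_minus field_simps)
qed

text \<open>The law is the image of the standard normal law under scaling by \<sigma>, which
  replaces \<open>s\<close> by \<open>s * \<sigma>\<close> in the characteristic function.\<close>

lemma char_normal:
  assumes "\<sigma> > 0"
  shows "char (dens (normal_density 0 \<sigma>)) s = exp (- of_real (\<sigma>\<^sup>2 * s\<^sup>2) / 2)"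
proof -
  interpret S: prob_space std_normal_distribution
    by (rule prob_space_normal_density) simp
  have "distributed std_normal_distribution lborel (\<lambda>x. x) (normal_density 0 1)"
    unfolding distributed_def using distr_id2[of lborel std_normal_distribution] by auto
  from S.normal_density_affine[OF this, of \<sigma> 0] assms
  have "distributed std_normal_distribution lborel (\<lambda>x. \<sigma> * x) (normal_density 0 \<sigma>)"
    by simp
  then have "distr std_normal_distribution lborel (\<lambda>x. \<sigma> * x) = dens (normal_density 0 \<sigma>)"
    unfolding dens_def by (rule distributed_distr_eq_density)
  then have "char (dens (normal_density 0 \<sigma>)) s = (CLINT x|std_normal_distribution. iexp (s * (\<sigma> * x)))"
    unfolding char_def by (subst (asm) eq_commute) (simp add: integral_distr)
  also have "\<dots> = char std_normal_distribution (s * \<sigma>)"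
    by (simp add: char_def mult.assoc)
  finally show ?thesis
    by (simp add: char_std_normal_distribution power_mult_distrib mult.commute exp_of_real[symmetric])
qed

lemma mass_functionsD:
  assumes "f \<in> mass_functions a"
  shows "integrable lborel f" "\<And>x. 0 \<le> f x" "(LINT x|lborel. f x) = a" "f \<in> borel_measurable borel"
  using assms unfolding mass_functions_def by (auto dest: borel_measurable_integrable)

lemma real_distribution_dens:
  assumes "f \<in> mass_functions 1"
  shows "real_distribution (dens f)"
proof -
  note f = mass_functionsD[OF assms]
  have "emeasure (dens f) (space (dens f)) = 1"
    using f by (simp add: dens_def emeasure_density nn_integral_eq_integral)
  then interpret prob_space "dens f" by (rule prob_spaceI)
  show ?thesis by standard (simp add: dens_def)
qed

section \<open>The displacement laws as a convolution semigroup\<close>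

locale jump_kernel =
  fixes p :: "real \<Rightarrow> real \<Rightarrow> real"
  assumes jump_density: "pstar p 0 \<in> mass_functions 1"
begin

abbreviation "jump \<equiv> dens (pstar p 0)"

sublocale jump: real_distribution jump
  by (rule real_distribution_dens[OF jump_density])

abbreviation "jumps \<equiv> \<Pi>\<^sub>M i\<in>(UNIV::nat set). jump"

sublocale jumps: product_prob_space "\<lambda>_. jump" "UNIV::nat set" ..

lemma jumps_component [measurable]: "(\<lambda>j. j i) \<in> borel_measurable jumps"
  using measurable_component_singleton[of i UNIV "\<lambda>_. jump"]
  by (simp cong: measurable_cong_sets)

lemma distr_jumps_component: "distr jumps borel (\<lambda>j. j i) = jump"
  using distr_PiM_component[of UNIV "\<lambda>_. jump" i] jump.prob_space_axioms
  by (simp cong: distr_cong)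

text \<open>Coordinates of a product measure are independent because their joint law is the product
  of the marginals. Hence the characteristic function of a sum of \<open>n\<close> jumps is an
  \<open>n\<close>-th power.\<close>

lemma indep_jumps: "jumps.indep_vars (\<lambda>_. borel) (\<lambda>i j. j i) {..<n}"
proof -
  have "jumps.indep_vars (\<lambda>_. borel) (\<lambda>i j. j i) UNIV"
  proof (subst jumps.indep_vars_iff_distr_eq_PiM')
    have "sets (\<Pi>\<^sub>M i\<in>(UNIV::nat set). borel) = sets jumps"
      by (intro sets_PiM_cong) auto
    then show "distr jumps (\<Pi>\<^sub>M i\<in>UNIV. borel) (\<lambda>x. \<lambda>i\<in>UNIV. x i) = (\<Pi>\<^sub>M i\<in>UNIV. distr jumps borel (\<lambda>j. j i))"
      by (simp add: distr_jumps_component restrict_UNIV distr_id2)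
  qed auto
  then show ?thesis by (rule jumps.indep_vars_subset) simp
qed

lemma char_sum_jumps:
  "(CLINT j|jumps. iexp (s * (\<Sum>i<n. j i))) = char jump s ^ n"
proof -
  have "char (distr jumps borel (\<lambda>j. \<Sum>i<n. j i)) s = (\<Prod>i<n. char (distr jumps borel (\<lambda>j. j i)) s)"
    by (rule jumps.char_distr_sum[OF indep_jumps])
  then show ?thesis
    by (simp add: distr_jumps_component char_def integral_distr)
qed

text \<open>Starting at 0 suffices, since \<open>Xstar x\<close> is \<open>x\<close> plus
  \<open>Xstar 0\<close>.\<close>

definition disp :: "real \<Rightarrow> real measure" where
  "disp t = distr (noise p t) borel (Xstar 0)"

lemma Xstar_measurable:
  "Xstar x \<in> borel_measurable (noise p t)"
proof -
  \<comment> \<open>The number of summands is itself random; as it takes countably many values,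
    measurability may be checked for each fixed value.\<close>
  have "(\<lambda>(n, j). \<Sum>i<n. j i) \<in> borel_measurable (measure_pmf (poisson_pmf t) \<Otimes>\<^sub>M jumps)"
    unfolding case_prod_beta
    by (rule measurable_compose_countable[where f="\<lambda>n z. \<Sum>i<n. snd z i" and g=fst]) auto
  note [measurable] = this[unfolded case_prod_beta]
  show ?thesis
    unfolding Xstar_def noise_def case_prod_beta dens_def[of "normal_density _ _"] by measurable
qed

text \<open>Fubini splits off the normal factor, and conditioning on the number of jumps leaves the
  Poisson generating function at \<open>char jump s\<close>. The exponent is linear in
  \<open>t\<close>, which is the source of the semigroup property.\<close>

lemma char_disp:
  assumes "t > 0"
  shows "char (disp t) s = exp (of_real t * (char jump s - 1 - of_real (s\<^sup>2 / 2)))"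
proof -
  let ?N = "dens (normal_density 0 (sqrt t))" and ?P = "measure_pmf (poisson_pmf t)"
  interpret N: prob_space ?N
    using prob_space_normal_density[of "sqrt t" 0] assms by (simp add: dens_def)
  interpret PJ: pair_prob_space ?P jumps ..
  interpret NPJ: pair_prob_space ?N "?P \<Otimes>\<^sub>M jumps" ..
  have [measurable]: "Xstar 0 \<in> borel_measurable (?N \<Otimes>\<^sub>M (?P \<Otimes>\<^sub>M jumps))"
    using Xstar_measurable[of 0 t] by (simp add: noise_def)
  have S: "(\<lambda>z. \<Sum>i<fst z. snd z i) \<in> borel_measurable (?P \<Otimes>\<^sub>M jumps)"
    by (rule measurable_compose_countable[where f="\<lambda>n z. \<Sum>i<n. snd z i" and g=fst]) auto
  note [measurable] = S
  have "char (disp t) s = (CLINT z|?N \<Otimes>\<^sub>M (?P \<Otimes>\<^sub>M jumps). iexp (s * Xstar 0 z))"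
    unfolding char_def disp_def noise_def by (subst integral_distr) auto
  also have "\<dots> = (CLINT b|?N. CLINT z|?P \<Otimes>\<^sub>M jumps. iexp (s * Xstar 0 (b, z)))"
    by (subst NPJ.integral_fst'[symmetric])
      (auto intro!: NPJ.P.integrable_const_bound[where B=1] AE_I2)
  also have "\<dots> = (CLINT b|?N. CLINT z|?P \<Otimes>\<^sub>M jumps. iexp (s * b) * iexp (s * (\<Sum>i<fst z. snd z i)))"
    by (simp add: Xstar_def case_prod_beta distrib_left exp_add)
  also have "\<dots> = char ?N s * (CLINT z|?P \<Otimes>\<^sub>M jumps. iexp (s * (\<Sum>i<fst z. snd z i)))"
    by (simp add: char_def)
  also have "(CLINT z|?P \<Otimes>\<^sub>M jumps. iexp (s * (\<Sum>i<fst z. snd z i)))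
      = (CLINT n|?P. CLINT j|jumps. iexp (s * (\<Sum>i<n. j i)))"
    by (subst PJ.integral_fst'[symmetric])
      (auto intro!: PJ.P.integrable_const_bound[where B=1] AE_I2)
  also have "\<dots> = (CLINT n|?P. char jump s ^ n)"
    by (simp only: char_sum_jumps)
  also have "\<dots> = exp (of_real t * char jump s - of_real t)"
    by (rule integral_poisson_pmf_power[OF assms jump.cmod_char_le_1])
  also have "char ?N s = exp (- of_real (t * s\<^sup>2) / 2)"
    using assms by (subst char_normal) auto
  finally show ?thesis
    by (simp add: exp_add[symmetric] algebra_simps)
qed

lemma real_distribution_disp:
  assumes "t > 0"
  shows "real_distribution (disp t)"
proof -
  interpret N: prob_space "dens (normal_density 0 (sqrt t))"
    using prob_space_normal_density[of "sqrt t" 0] assms by (simp add: dens_def)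
  interpret PJ: pair_prob_space "measure_pmf (poisson_pmf t)" jumps ..
  interpret NPJ: pair_prob_space "dens (normal_density 0 (sqrt t))"
    "measure_pmf (poisson_pmf t) \<Otimes>\<^sub>M jumps" ..
  show ?thesis
    using NPJ.P.real_distribution_distr[of "Xstar 0"] Xstar_measurable[of 0 t]
    by (simp add: disp_def noise_def)
qed

text \<open>The exponents for \<open>s\<close> and \<open>t\<close> add up to the one for
  \<open>s + t\<close>, and a law on the line is determined by its characteristic function.\<close>

lemma disp_add:
  assumes "s > 0" "t > 0"
  shows "distr (disp s \<Otimes>\<^sub>M disp t) borel (\<lambda>(x, y). x + y) = disp (s + t)"
proof (rule Levy_uniqueness)
  interpret s: real_distribution "disp s" by (rule real_distribution_disp) fact
  interpret t: real_distribution "disp t" by (rule real_distribution_disp) fact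
  interpret st: pair_prob_space "disp s" "disp t" ..
  show "real_distribution (distr (disp s \<Otimes>\<^sub>M disp t) borel (\<lambda>(x, y). x + y))"
    by (rule st.P.real_distribution_distr) (simp add: case_prod_beta)
  show "real_distribution (disp (s + t))"
    using assms by (intro real_distribution_disp) auto
  show "char (distr (disp s \<Otimes>\<^sub>M disp t) borel (\<lambda>(x, y). x + y)) = char (disp (s + t))"
    using assms
    by (simp add: fun_eq_iff s.char_add_distr[OF t.real_distribution_axioms] char_disp
        exp_add[symmetric] distrib_right)
qed

end

section \<open>Tail functions and the free evolution\<close>

text \<open>Values in \<open>ennreal\<close> allow Tonelli and suprema to be used without
  integrability conditions.\<close>

definition tail :: "(real \<Rightarrow> real) \<Rightarrow> real \<Rightarrow> ennreal" where
  "tail f r = emeasure (dens f) {r..}"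

lemma tail_nn_integral:
  "f \<in> borel_measurable borel \<Longrightarrow> tail f r = (\<integral>\<^sup>+ x. ennreal (f x) * indicator {r..} x \<partial>lborel)"
  by (simp add: tail_def dens_def emeasure_density)

lemma tail_le_iff: "dens f \<preceq> dens g \<longleftrightarrow> tail f \<le> tail g"
  by (simp add: tail_le_def tail_def le_fun_def)

lemma tail_measurable [measurable]:
  assumes [measurable]: "f \<in> borel_measurable borel"
  shows "tail f \<in> borel_measurable borel"
proof -
  have "tail f = (\<lambda>r. \<integral>\<^sup>+ x. ennreal (f x) * indicator {z. fst z \<le> snd z} (r, x) \<partial>lborel)"
    by (intro ext) (auto simp: tail_nn_integral indicator_def intro!: nn_integral_cong)
  then show ?thesis by simp
qed

lemma nn_integral_mass:
  assumes "f \<in> mass_functions a"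
  shows "(\<integral>\<^sup>+ x. ennreal (f x) \<partial>lborel) = ennreal a"
  using mass_functionsD[OF assms] by (simp add: nn_integral_eq_integral)

lemma tail_le_mass:
  assumes "f \<in> mass_functions a"
  shows "tail f r \<le> ennreal a"
proof -
  have "tail f r \<le> (\<integral>\<^sup>+ x. ennreal (f x) \<partial>lborel)"
    unfolding tail_nn_integral[OF mass_functionsD(4)[OF assms]]
    by (intro nn_integral_mono) (auto simp: indicator_def)
  then show ?thesis by (simp add: nn_integral_mass[OF assms])
qed

lemma mass_functionsI:
  assumes "f \<in> borel_measurable borel" "\<And>x. 0 \<le> f x" "a \<ge> 0"
    and "(\<integral>\<^sup>+ x. ennreal (f x) \<partial>lborel) = ennreal a"
  shows "f \<in> mass_functions a"
proof -
  have i: "integrable lborel f"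
    using assms by (intro integrableI_nonneg) auto
  moreover have "ennreal (LINT x|lborel. f x) = ennreal a"
    using nn_integral_eq_integral[OF i] assms by simp
  ultimately show ?thesis
    using assms by (simp add: mass_functions_def)
qed

lemma Tstar_cmult: "Tstar p t (\<lambda>x. c * f x) = (\<lambda>x. c * Tstar p t f x)"
  by (simp add: Tstar_def fun_eq_iff)

section \<open>The free evolution acting on masses, tails and L1 distances\<close>

context jump_kernel
begin

lemma Tstar_eq:
  assumes [measurable]: "f \<in> borel_measurable borel"
  shows "Tstar p t f x = exp t * (LINT y|disp t. f (x + y))"
proof -
  have "(LINT y|disp t. f (x + y)) = (LINT \<omega>|noise p t. f (x + Xstar 0 \<omega>))"
    unfolding disp_def by (rule integral_distr) (use Xstar_measurable in auto)
  moreover have "x + Xstar 0 \<omega> = Xstar x \<omega>" for \<omega>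
    by (simp add: Xstar_def split: prod.split)
  ultimately show ?thesis by (simp add: Tstar_def)
qed

definition tail_evol :: "real \<Rightarrow> (real \<Rightarrow> ennreal) \<Rightarrow> real \<Rightarrow> ennreal" where
  "tail_evol t F r = ennreal (exp t) * (\<integral>\<^sup>+ y. F (r + y) \<partial>disp t)"

lemma tail_evol_mono: "F \<le> G \<Longrightarrow> tail_evol t F \<le> tail_evol t G"
  unfolding tail_evol_def le_fun_def by (intro allI mult_left_mono nn_integral_mono) auto

lemma sets_disp [simp, measurable_cong]: "sets (disp t) = sets borel"
  by (simp add: disp_def)

lemma space_disp [simp]: "space (disp t) = UNIV"
  by (simp add: disp_def)

context
  fixes t :: real
  assumes t: "t > 0"
begin

interpretation D: real_distribution "disp t"
  by (rule real_distribution_disp[OF t])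

interpretation LD: pair_sigma_finite lborel "disp t" ..

text \<open>Tonelli, followed by the translation invariance of Lebesgue measure, moves the shift
  from \<open>f\<close> to the set. \<open>B = UNIV\<close> gives the total mass,
  \<open>B = {r..}\<close> the tail.\<close>

lemma nn_integral_shift:
  fixes f :: "real \<Rightarrow> ennreal"
  assumes [measurable]: "f \<in> borel_measurable borel" "B \<in> sets borel"
  shows "(\<integral>\<^sup>+ x. (\<integral>\<^sup>+ y. f (x + y) \<partial>disp t) * indicator B x \<partial>lborel)
    = (\<integral>\<^sup>+ y. (\<integral>\<^sup>+ x. f x * indicator B (x - y) \<partial>lborel) \<partial>disp t)"
proof -
  have "(\<integral>\<^sup>+ x. (\<integral>\<^sup>+ y. f (x + y) \<partial>disp t) * indicator B x \<partial>lborel)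
      = (\<integral>\<^sup>+ x. (\<integral>\<^sup>+ y. f (x + y) * indicator B x \<partial>disp t) \<partial>lborel)"
    by (simp add: nn_integral_multc)
  also have "\<dots> = (\<integral>\<^sup>+ y. (\<integral>\<^sup>+ x. f (x + y) * indicator B x \<partial>lborel) \<partial>disp t)"
    by (rule LD.Fubini'[symmetric]) measurable
  also have "\<dots> = (\<integral>\<^sup>+ y. (\<integral>\<^sup>+ x. f x * indicator B (x - y) \<partial>lborel) \<partial>disp t)"
  proof (rule nn_integral_cong)
    fix y
    show "(\<integral>\<^sup>+ x. f (x + y) * indicator B x \<partial>lborel) = (\<integral>\<^sup>+ x. f x * indicator B (x - y) \<partial>lborel)"
      using nn_integral_real_affine[of "\<lambda>x. f x * indicator B (x - y)" 1 y]
      by (simp add: add.commute)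
  qed
  finally show ?thesis .
qed

lemma tail_evol_const: "tail_evol t (\<lambda>_. c) = (\<lambda>_. ennreal (exp t) * c)"
  using D.emeasure_space_1 by (simp add: tail_evol_def fun_eq_iff)

context
  fixes f :: "real \<Rightarrow> real" and a :: real
  assumes f: "f \<in> mass_functions a"
begin

lemma nonneg_mass: "a \<ge> 0"
  using mass_functionsD[OF f] integral_nonneg_AE[of f lborel] by auto

text \<open>An integrable \<open>f\<close> may be unbounded, so the average over the displacement
  can diverge at some \<open>x\<close>; its integral over \<open>x\<close> is finite, which confines
  this to a null set. At such \<open>x\<close> the Bochner integral in \<open>Tstar\<close> takes
  its default value 0, so identities for it are stated almost everywhere.\<close>

lemma integrable_shift: "AE x in lborel. integrable (disp t) (\<lambda>y. f (x + y))"
proof -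
  note [measurable] = mass_functionsD(4)[OF f]
  have "(\<integral>\<^sup>+ x. (\<integral>\<^sup>+ y. f (x + y) \<partial>disp t) \<partial>lborel) = ennreal a"
    using nn_integral_shift[of f UNIV] D.emeasure_space_1 by (simp add: nn_integral_mass[OF f])
  then have "AE x in lborel. (\<integral>\<^sup>+ y. f (x + y) \<partial>disp t) \<noteq> \<infinity>"
    by (intro nn_integral_PInf_AE) auto
  then show ?thesis
    by eventually_elim
      (auto intro!: integrableI_nonneg AE_I2 simp: mass_functionsD(2)[OF f] top.not_eq_extremum)
qed

lemma Tstar_nn: "AE x in lborel. ennreal (Tstar p t f x) = ennreal (exp t) * (\<integral>\<^sup>+ y. f (x + y) \<partial>disp t)"
  using integrable_shift
  by eventually_elim
    (simp add: Tstar_eq mass_functionsD[OF f] ennreal_mult' nn_integral_eq_integral)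

lemma Tstar_measurable: "Tstar p t f \<in> borel_measurable borel"
proof -
  note [measurable] = mass_functionsD(4)[OF f]
  show ?thesis
    unfolding Tstar_eq[OF mass_functionsD(4)[OF f], abs_def] by measurable
qed

lemma Tstar_mass: "Tstar p t f \<in> mass_functions (exp t * a)"
proof (rule mass_functionsI)
  note [measurable] = mass_functionsD(4)[OF f]
  show "0 \<le> Tstar p t f x" for x
    by (simp add: Tstar_eq mass_functionsD[OF f])
  have "(\<integral>\<^sup>+ x. ennreal (Tstar p t f x) \<partial>lborel) =
     (\<integral>\<^sup>+ x. ennreal (exp t) * (\<integral>\<^sup>+ y. f (x + y) \<partial>disp t) \<partial>lborel)"
    by (rule nn_integral_cong_AE) (rule Tstar_nn)
  also have "\<dots> = ennreal (exp t) * (\<integral>\<^sup>+ x. (\<integral>\<^sup>+ y. f (x + y) \<partial>disp t) \<partial>lborel)"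
    by (rule nn_integral_cmult) measurable
  also have "(\<integral>\<^sup>+ x. (\<integral>\<^sup>+ y. f (x + y) \<partial>disp t) \<partial>lborel) = ennreal a"
    using nn_integral_shift[of f UNIV] D.emeasure_space_1 by (simp add: nn_integral_mass[OF f])
  finally show "(\<integral>\<^sup>+ x. ennreal (Tstar p t f x) \<partial>lborel) = ennreal (exp t * a)"
    by (simp add: ennreal_mult')
qed (use nonneg_mass Tstar_measurable in auto)

lemma tail_Tstar: "tail (Tstar p t f) = tail_evol t (tail f)"
proof (rule ext)
  fix r
  note [measurable] = mass_functionsD(4)[OF f]
  have "tail (Tstar p t f) r = (\<integral>\<^sup>+ x. ennreal (Tstar p t f x) * indicator {r..} x \<partial>lborel)"
    by (rule tail_nn_integral[OF Tstar_measurable])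
  also have "\<dots> = (\<integral>\<^sup>+ x. ennreal (exp t) * ((\<integral>\<^sup>+ y. f (x + y) \<partial>disp t) * indicator {r..} x) \<partial>lborel)"
    using Tstar_nn by (intro nn_integral_cong_AE) (auto simp: mult.assoc)
  also have "\<dots> = ennreal (exp t) * (\<integral>\<^sup>+ x. (\<integral>\<^sup>+ y. f (x + y) \<partial>disp t) * indicator {r..} x \<partial>lborel)"
    by (rule nn_integral_cmult) measurable
  also have "(\<integral>\<^sup>+ x. (\<integral>\<^sup>+ y. f (x + y) \<partial>disp t) * indicator {r..} x \<partial>lborel)
      = (\<integral>\<^sup>+ y. (\<integral>\<^sup>+ x. ennreal (f x) * indicator {r..} (x - y) \<partial>lborel) \<partial>disp t)"
    by (rule nn_integral_shift) auto
  \<comment> \<open>The point \<open>x - y\<close> lies in \<open>{r..}\<close> exactly when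
    \<open>x\<close> lies in \<open>{r + y..}\<close>, so the inner integral is a tail at the
    shifted point.\<close>
  also have "\<dots> = (\<integral>\<^sup>+ y. tail f (r + y) \<partial>disp t)"
    by (auto intro!: nn_integral_cong simp: tail_nn_integral indicator_def)
  finally show "tail (Tstar p t f) r = tail_evol t (tail f) r"
    by (simp add: tail_evol_def)
qed

end

text \<open>Almost everywhere the evolved difference is dominated by the evolution of
  \<open>\<bar>f x - g x\<bar>\<close>, whose mass grows exactly by the factor
  \<open>exp t\<close>.\<close>

lemma Tstar_L1:
  assumes f: "f \<in> mass_functions a" and g: "g \<in> mass_functions b"
  shows "(LINT x|lborel. \<bar>Tstar p t f x - Tstar p t g x\<bar>) \<le> exp t * (LINT x|lborel. \<bar>f x - g x\<bar>)"
proof -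
  have h: "(\<lambda>x. \<bar>f x - g x\<bar>) \<in> mass_functions (LINT x|lborel. \<bar>f x - g x\<bar>)"
    using mass_functionsD(1)[OF f] mass_functionsD(1)[OF g] by (simp add: mass_functions_def)
  have "(LINT x|lborel. \<bar>Tstar p t f x - Tstar p t g x\<bar>) \<le> (LINT x|lborel. Tstar p t (\<lambda>x. \<bar>f x - g x\<bar>) x)"
  proof (rule integral_mono_AE)
    show "AE x in lborel. \<bar>Tstar p t f x - Tstar p t g x\<bar> \<le> Tstar p t (\<lambda>x. \<bar>f x - g x\<bar>) x"
      using integrable_shift[OF f] integrable_shift[OF g]
    proof eventually_elim
      case (elim x)
      have "\<bar>LINT y|disp t. f (x + y) - g (x + y)\<bar> \<le> (LINT y|disp t. \<bar>f (x + y) - g (x + y)\<bar>)"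
        by (rule integral_abs_bound)
      then show ?case
        using elim
        by (simp add: Tstar_eq mass_functionsD(4)[OF f] mass_functionsD(4)[OF g]
            mass_functionsD(4)[OF h] right_diff_distrib[symmetric] abs_mult)
    qed
  qed (use mass_functionsD(1)[OF Tstar_mass[OF f]] mass_functionsD(1)[OF Tstar_mass[OF g]]
      mass_functionsD(1)[OF Tstar_mass[OF h]] in auto)
  also have "\<dots> = exp t * (LINT x|lborel. \<bar>f x - g x\<bar>)"
    using mass_functionsD(3)[OF Tstar_mass[OF h]] .
  finally show ?thesis .
qed

lemma Tstar_le:
  assumes "f \<in> borel_measurable borel" "\<And>x. f x \<le> c" "c \<ge> 0"
  shows "Tstar p t f x \<le> exp t * c"
proof -
  have "(LINT y|disp t. f (x + y)) \<le> c"
  \<comment> \<open>Without integrability the integral has the default value 0, and the bound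
    follows from \<open>c \<ge> 0\<close>.\<close>
  proof (cases "integrable (disp t) (\<lambda>y. f (x + y))")
    case True
    then have "(LINT y|disp t. f (x + y)) \<le> (LINT y|disp t. c)"
      by (intro integral_mono) (use assms in auto)
    then show ?thesis using D.prob_space by simp
  qed (use assms in \<open>simp add: not_integrable_integral_eq\<close>)
  then show ?thesis by (simp add: Tstar_eq[OF assms(1)])
qed

end

text \<open>Iterating averages over two independent displacements, whose sum has law
  \<open>disp (s + t)\<close>.\<close>

lemma tail_evol_add:
  assumes "s > 0" "t > 0" and [measurable]: "F \<in> borel_measurable borel"
  shows "tail_evol s (tail_evol t F) = tail_evol (s + t) F"
proof (rule ext)
  fix r
  interpret s: real_distribution "disp s" by (rule real_distribution_disp) fact
  interpret t: real_distribution "disp t" by (rule real_distribution_disp) fact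
  have "(\<integral>\<^sup>+ z. F (r + z) \<partial>disp (s + t)) = (\<integral>\<^sup>+ z. F (r + (fst z + snd z)) \<partial>(disp s \<Otimes>\<^sub>M disp t))"
    unfolding disp_add[OF assms(1,2), symmetric]
    by (subst nn_integral_distr) (auto simp: case_prod_beta)
  also have "\<dots> = (\<integral>\<^sup>+ x. (\<integral>\<^sup>+ y. F (r + x + y) \<partial>disp t) \<partial>disp s)"
    by (subst t.nn_integral_fst[symmetric]) (auto simp: add.assoc)
  finally show "tail_evol s (tail_evol t F) r = tail_evol (s + t) F r"
    by (simp add: tail_evol_def nn_integral_cmult exp_add ennreal_mult' mult.assoc)
qed

end

section \<open>Cuts\<close>

lemma finite_borel_measure_dens:
  assumes "v \<in> mass_functions a"
  shows "finite_borel_measure (dens v)"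
proof -
  have "emeasure (dens v) (space (dens v)) = ennreal a"
    using nn_integral_mass[OF assms] mass_functionsD(4)[OF assms]
    by (simp add: dens_def emeasure_density)
  then interpret finite_measure "dens v" by (intro finite_measureI) simp
  show ?thesis by standard (simp add: dens_def)
qed

lemma emeasure_dens_singleton:
  assumes [measurable]: "v \<in> borel_measurable borel"
  shows "emeasure (dens v) {x} = 0"
proof -
  have "AE y in lborel. y \<noteq> x"
    by (rule AE_lborel_singleton)
  then have "AE y in lborel. ennreal (v y) * indicator {x} y = 0"
    by eventually_elim simp
  then show ?thesis
    by (simp add: dens_def emeasure_density nn_integral_0_iff_AE)
qed

lemma measure_dens:
  assumes v: "v \<in> mass_functions a" and [measurable]: "B \<in> sets borel"
  shows "measure (dens v) B = (LINT x:B|lborel. v x)"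
proof -
  note mv = mass_functionsD[OF v]
  note [measurable] = mv(4)
  have i: "integrable lborel (\<lambda>x. indicator B x *\<^sub>R v x)"
    using mv by (intro integrable_mult_indicator) auto
  have "emeasure (dens v) B = (\<integral>\<^sup>+ x. ennreal (indicator B x *\<^sub>R v x) \<partial>lborel)"
    by (auto simp: dens_def emeasure_density indicator_def intro!: nn_integral_cong)
  also have "\<dots> = ennreal (LINT x:B|lborel. v x)"
    unfolding set_lebesgue_integral_def
    by (rule nn_integral_eq_integral[OF i]) (auto simp: mv)
  finally show ?thesis
    using mv by (simp add: measure_def set_lebesgue_integral_def)
qed

lemma tail_eq_ennreal:
  assumes v: "v \<in> mass_functions a"
  shows "tail v r = ennreal (LINT x:{r..}|lborel. v x)"
proof -
  interpret finite_borel_measure "dens v" by (rule finite_borel_measure_dens[OF v])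
  show ?thesis
    by (simp add: tail_def emeasure_eq_measure measure_dens[OF v])
qed

text \<open>Both \<open>{r..}\<close> and the half-line of the distribution function contain
  \<open>r\<close>; the point is harmless because a density gives it no mass.\<close>

lemma tail_eq_cdf:
  assumes v: "v \<in> mass_functions a"
  shows "(LINT x:{r..}|lborel. v x) = a - cdf (dens v) r"
proof -
  note mv = mass_functionsD[OF v]
  interpret finite_borel_measure "dens v" by (rule finite_borel_measure_dens[OF v])
  have "measure (dens v) {r..} = measure (dens v) (space (dens v) - {..<r})"
    by (rule arg_cong[where f="measure (dens v)"]) (auto simp: borel_UNIV)
  also have "\<dots> = a - measure (dens v) {..<r}"
    using mv by (subst finite_measure_compl)
      (auto simp: measure_dens[OF v] borel_UNIV set_lebesgue_integral_def)
  also have "measure (dens v) {..<r} = cdf (dens v) r"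
  proof -
    have "measure (dens v) ({..<r} \<union> {r}) = measure (dens v) {..<r} + measure (dens v) {r}"
      by (rule finite_measure_Union) auto
    moreover have "{..<r} \<union> {r} = {..r}" by auto
    ultimately show ?thesis
      using emeasure_dens_singleton[OF mv(4), of r] by (simp add: cdf_def measure_def)
  qed
  finally show ?thesis
    by (simp add: measure_dens[OF v])
qed

lemma cdf_dens_at_top:
  assumes v: "v \<in> mass_functions a"
  shows "(cdf (dens v) \<longlongrightarrow> a) at_top"
proof -
  interpret finite_borel_measure "dens v" by (rule finite_borel_measure_dens[OF v])
  have "measure (dens v) (space (dens v)) = a"
    using mass_functionsD[OF v] by (simp add: measure_dens[OF v] borel_UNIV set_lebesgue_integral_def)
  then show ?thesis using cdf_lim_at_top by simp
qed

text \<open>The distribution function is continuous with limits 0 and \<open>a\<close>, so the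
  intermediate value theorem gives a finite point where it equals \<open>a - m\<close>, which lies
  strictly between them.\<close>

lemma cut_point_exists:
  assumes v: "v \<in> mass_functions a" and m: "0 < m" "m < a"
  shows "\<exists>V. (LINT x:{V..}|lborel. v x) = m"
proof -
  note mv = mass_functionsD[OF v]
  interpret finite_borel_measure "dens v" by (rule finite_borel_measure_dens[OF v])
  have cont: "continuous_on {x..y} (cdf (dens v))" for x y
    by (intro continuous_at_imp_continuous_on ballI)
      (simp add: isCont_cdf measure_def emeasure_dens_singleton mv)
  have "\<exists>x. cdf (dens v) x < a - m" "\<exists>y. cdf (dens v) y > a - m"
    using order_tendstoD(2)[OF cdf_lim_at_bot, of "a - m"]
      order_tendstoD(1)[OF cdf_dens_at_top[OF v], of "a - m"] m
    by (auto dest!: eventually_happens)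
  then obtain x y where xy: "cdf (dens v) x < a - m" "cdf (dens v) y > a - m" by blast
  then have "x \<le> y"
    using cdf_nondecreasing[of y x] by linarith
  then obtain V where "cdf (dens v) V = a - m"
    using IVT'[of "cdf (dens v)" x "a - m" y] xy cont by auto
  then show ?thesis
    by (intro exI[of _ V]) (simp add: tail_eq_cdf[OF v])
qed

lemma cut_point_eq:
  assumes "v \<in> mass_functions a" "0 < m" "m < a"
  shows "(LINT x:{cut_point m v..}|lborel. v x) = m"
  using cut_point_exists[OF assms] unfolding cut_point_def by (rule someI_ex)

lemma cut_measurable:
  assumes [measurable]: "v \<in> borel_measurable borel"
  shows "cut m v \<in> borel_measurable borel"
  unfolding cut_def[abs_def] by measurable

lemma cut_le: "0 \<le> v x \<Longrightarrow> cut m v x \<le> v x"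
  by (simp add: cut_def indicator_def)

lemma cut_mass:
  assumes v: "v \<in> mass_functions a" and m: "0 < m" "m < a"
  shows "cut m v \<in> mass_functions m"
  using cut_point_eq[OF assms] mass_functionsD[OF v]
    integrable_mult_indicator[of "{cut_point m v..}" lborel v]
  by (auto simp: mass_functions_def cut_def[abs_def] set_lebesgue_integral_def)

lemma tail_antimono: "r \<le> s \<Longrightarrow> tail v s \<le> tail v r"
  unfolding tail_def by (rule emeasure_mono) (auto simp: dens_def)

text \<open>Cutting at \<open>V\<close> turns the tail at \<open>r\<close> into the original tail at
  \<open>max V r\<close>; since tails are antitone and the tail at \<open>V\<close> is
  \<open>m\<close>, this is a minimum. In particular the choice among several cut points leaves no
  trace.\<close>

lemma tail_cut:
  assumes v: "v \<in> mass_functions a" and m: "0 < m" "m < a"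
  shows "tail (cut m v) = (\<lambda>r. min (ennreal m) (tail v r))"
proof (rule ext)
  fix r
  let ?V = "cut_point m v"
  note mv = mass_functionsD[OF v]
  have "tail (cut m v) r = (\<integral>\<^sup>+ x. ennreal (v x) * indicator {max ?V r..} x \<partial>lborel)"
    unfolding tail_nn_integral[OF cut_measurable[OF mv(4)]]
    by (auto intro!: nn_integral_cong simp: cut_def indicator_def)
  then have *: "tail (cut m v) r = tail v (max ?V r)"
    by (simp add: tail_nn_integral mv)
  have V: "tail v ?V = ennreal m"
    by (simp add: tail_eq_ennreal[OF v] cut_point_eq[OF assms])
  show "tail (cut m v) r = min (ennreal m) (tail v r)"
    using tail_antimono[of ?V r v] tail_antimono[of r ?V v] V
    unfolding * by (cases "?V \<le> r") (auto simp: max_def min_def)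
qed

text \<open>Both cut points are chosen by \<open>SOME\<close> from equivalent predicates, so they
  coincide and the identity holds at every point.\<close>

lemma cut_cmult:
  assumes "c > 0"
  shows "cut m (\<lambda>x. c * v x) = (\<lambda>x. c * cut (m / c) v x)"
proof -
  have "cut_point m (\<lambda>x. c * v x) = cut_point (m / c) v"
    using assms by (simp add: cut_point_def field_simps)
  then show ?thesis by (simp add: cut_def fun_eq_iff)
qed

text \<open>Right of \<open>V\<close> the cut functions differ by
  \<open>\<bar>u x - v x\<bar>\<close>; between \<open>U\<close> and \<open>V\<close> only
  \<open>u\<close> survives. As total and retained masses agree, the mass of \<open>u\<close> there
  is the excess of \<open>u\<close> over \<open>v\<close> left of \<open>V\<close>, which is at most
  the L1 distance on that half-line.\<close>

lemma cut_L1_le: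
  assumes u: "u \<in> mass_functions a" and v: "v \<in> mass_functions a"
    and U: "(LINT x:{U..}|lborel. u x) = m" and V: "(LINT x:{V..}|lborel. v x) = m"
    and UV: "U \<le> V"
  shows "(LINT x|lborel. \<bar>indicator {U..} x * u x - indicator {V..} x * v x\<bar>)
    \<le> (LINT x|lborel. \<bar>u x - v x\<bar>)"
proof -
  note mu = mass_functionsD[OF u] and mv = mass_functionsD[OF v]
  have i: "integrable lborel (\<lambda>x. indicator B x * h x)" if "integrable lborel h" "B \<in> sets borel"
    for B and h :: "real \<Rightarrow> real"
    using integrable_mult_indicator[of B lborel h] that by simp
  have d: "integrable lborel (\<lambda>x. \<bar>u x - v x\<bar>)" using mu mv by simp
  have "(LINT x|lborel. \<bar>indicator {U..} x * u x - indicator {V..} x * v x\<bar>)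
     = (LINT x|lborel. indicator {V..} x * \<bar>u x - v x\<bar> + (indicator {U..} x * u x - indicator {V..} x * u x))"
    using UV by (intro Bochner_Integration.integral_cong) (auto simp: indicator_def mu)
  also have "\<dots> = (LINT x|lborel. indicator {V..} x * \<bar>u x - v x\<bar>)
      + ((LINT x|lborel. indicator {U..} x * u x) - (LINT x|lborel. indicator {V..} x * u x))"
    using i[OF d] i[OF mu(1)] by simp
  also have "(LINT x|lborel. indicator {U..} x * u x) = m"
    using U by (simp add: set_lebesgue_integral_def)
  also have "(LINT x|lborel. indicator {V..} x * u x) = a - (LINT x|lborel. indicator {..<V} x * u x)"
  proof -
    have "a = (LINT x|lborel. indicator {V..} x * u x + indicator {..<V} x * u x)"
      unfolding mu(3)[symmetric] by (intro Bochner_Integration.integral_cong) (auto simp: indicator_def)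
    then show ?thesis using i[OF mu(1)] by simp
  qed
  also have "m = a - (LINT x|lborel. indicator {..<V} x * v x)"
  proof -
    have "a = (LINT x|lborel. indicator {V..} x * v x + indicator {..<V} x * v x)"
      unfolding mv(3)[symmetric] by (intro Bochner_Integration.integral_cong) (auto simp: indicator_def)
    then show ?thesis using i[OF mv(1)] V by (simp add: set_lebesgue_integral_def)
  qed
  also have "(LINT x|lborel. indicator {V..} x * \<bar>u x - v x\<bar>) +
      (a - (LINT x|lborel. indicator {..<V} x * v x) - (a - (LINT x|lborel. indicator {..<V} x * u x)))
     = (LINT x|lborel. indicator {V..} x * \<bar>u x - v x\<bar> + (indicator {..<V} x * u x - indicator {..<V} x * v x))"
    using i[OF d] i[OF mu(1)] i[OF mv(1)] by simp
  also have "\<dots> \<le> (LINT x|lborel. \<bar>u x - v x\<bar>)"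
  proof (rule integral_mono)
    show "integrable lborel
      (\<lambda>x. indicator {V..} x * \<bar>u x - v x\<bar> + (indicator {..<V} x * u x - indicator {..<V} x * v x))"
      using i[OF d] i[OF mu(1)] i[OF mv(1)] by simp
  qed (use d in \<open>auto simp: indicator_def\<close>)
  finally show ?thesis .
qed

lemma cut_L1:
  assumes u: "u \<in> mass_functions a" and v: "v \<in> mass_functions a" and m: "0 < m" "m < a"
  shows "(LINT x|lborel. \<bar>cut m u x - cut m v x\<bar>) \<le> (LINT x|lborel. \<bar>u x - v x\<bar>)"
proof (cases "cut_point m u \<le> cut_point m v")
  case True
  then show ?thesis
    unfolding cut_def using cut_L1_le[OF u v] cut_point_eq[OF u m] cut_point_eq[OF v m] by blast
next
  case False
  then have "cut_point m v \<le> cut_point m u" by simp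
  then show ?thesis
    unfolding cut_def
    using cut_L1_le[OF v u cut_point_eq[OF v m] cut_point_eq[OF u m]]
    by (simp add: abs_minus_commute)
qed

text \<open>The cut removes mass \<open>1 - exp (-\<delta>)\<close> and the rescaling puts the same
  amount back elsewhere; each contributes at most \<delta>.\<close>

lemma scaled_cut_L1:
  assumes v: "v \<in> mass_functions 1" and "\<delta> > 0"
  shows "(LINT x|lborel. \<bar>exp \<delta> * cut (exp (-\<delta>)) v x - v x\<bar>) \<le> 2 * \<delta>"
proof -
  let ?c = "cut (exp (-\<delta>)) v"
  have c: "?c \<in> mass_functions (exp (-\<delta>))"
    by (rule cut_mass[OF v]) (use assms in auto)
  note mc = mass_functionsD[OF c] and mv = mass_functionsD[OF v]
  have "(LINT x|lborel. \<bar>exp \<delta> * ?c x - v x\<bar>) \<le> (LINT x|lborel. (exp \<delta> - 1) * ?c x + (v x - ?c x))"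
  proof (rule integral_mono)
    fix x
    have "0 \<le> (exp \<delta> - 1) * ?c x"
      using assms mc by simp
    moreover have "?c x \<le> v x" by (rule cut_le) (rule mv)
    ultimately show "\<bar>exp \<delta> * ?c x - v x\<bar> \<le> (exp \<delta> - 1) * ?c x + (v x - ?c x)"
      by (simp add: algebra_simps abs_le_iff)
  qed (use mc mv in auto)
  also have "\<dots> = (exp \<delta> - 1) * exp (-\<delta>) + (1 - exp (-\<delta>))"
    using mc mv by simp
  also have "\<dots> = 2 * (1 - exp (-\<delta>))"
    by (simp add: algebra_simps exp_minus)
  also have "\<dots> \<le> 2 * \<delta>"
    using exp_ge_add_one_self[of "-\<delta>"] by simp
  finally show ?thesis .
qed

section \<open>Monotonicity and closeness of the barriers\<close>

context jump_kernel
begin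

abbreviation low :: "real \<Rightarrow> (real \<Rightarrow> real) \<Rightarrow> real \<Rightarrow> real" where
  "low \<delta> \<equiv> Tstar p \<delta> \<circ> Cminus \<delta>"

abbreviation up :: "real \<Rightarrow> (real \<Rightarrow> real) \<Rightarrow> real \<Rightarrow> real" where
  "up \<delta> \<equiv> Cplus \<delta> \<circ> Tstar p \<delta>"

lemma Cminus_mass: "\<delta> > 0 \<Longrightarrow> f \<in> mass_functions 1 \<Longrightarrow> Cminus \<delta> f \<in> mass_functions (exp (- \<delta>))"
  unfolding Cminus_def by (rule cut_mass) auto

lemma low_mass: "\<delta> > 0 \<Longrightarrow> f \<in> mass_functions 1 \<Longrightarrow> low \<delta> f \<in> mass_functions 1"
  using Tstar_mass[OF _ Cminus_mass, of \<delta> \<delta> f] by (simp add: exp_minus)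

lemma up_mass: "\<delta> > 0 \<Longrightarrow> f \<in> mass_functions 1 \<Longrightarrow> up \<delta> f \<in> mass_functions 1"
  using cut_mass[OF Tstar_mass, of \<delta> f 1 1] by (simp add: Cplus_def)

lemma tail_low:
  assumes "\<delta> > 0" "f \<in> mass_functions 1"
  shows "tail (low \<delta> f) = tail_evol \<delta> (\<lambda>r. min (ennreal (exp (- \<delta>))) (tail f r))"
  using tail_Tstar[OF assms(1) Cminus_mass[OF assms]] tail_cut[OF assms(2), of "exp (- \<delta>)"] assms(1)
  by (simp add: Cminus_def)

lemma tail_up:
  assumes "\<delta> > 0" "f \<in> mass_functions 1"
  shows "tail (up \<delta> f) = (\<lambda>r. min 1 (tail_evol \<delta> (tail f) r))"
  using tail_cut[OF Tstar_mass[OF assms], of 1] assms(1) tail_Tstar[OF assms]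
  by (simp add: Cplus_def)

lemma tail_low_mono:
  assumes "\<delta> > 0" "f \<in> mass_functions 1" "g \<in> mass_functions 1" "tail f \<le> tail g"
  shows "tail (low \<delta> f) \<le> tail (low \<delta> g)"
  unfolding tail_low[OF assms(1,2)] tail_low[OF assms(1,3)]
  by (intro tail_evol_mono le_funI min.mono) (use assms(4) in \<open>auto simp: le_fun_def\<close>)

lemma tail_up_mono:
  assumes "\<delta> > 0" "f \<in> mass_functions 1" "g \<in> mass_functions 1" "tail f \<le> tail g"
  shows "tail (up \<delta> f) \<le> tail (up \<delta> g)"
  unfolding tail_up[OF assms(1,2)] tail_up[OF assms(1,3)]
  using tail_evol_mono[OF assms(4), of \<delta>] by (intro le_funI min.mono) (auto simp: le_fun_def)

text \<open>The lower step is bounded by the evolution of \<open>g\<close>, since its cut only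
  lowers tails, and by 1, since its total mass is 1. The minimum of these bounds is the upper
  step.\<close>

lemma tail_low_le_up:
  assumes "\<delta> > 0" "f \<in> mass_functions 1" "g \<in> mass_functions 1" "tail f \<le> tail g"
  shows "tail (low \<delta> f) \<le> tail (up \<delta> g)"
proof -
  have "tail (low \<delta> f) \<le> tail_evol \<delta> (tail g)"
    unfolding tail_low[OF assms(1,2)]
    by (intro tail_evol_mono le_funI) (use assms(4) in \<open>auto simp: le_fun_def min.coboundedI2\<close>)
  moreover have "tail (low \<delta> f) \<le> (\<lambda>_. 1)"
    using tail_le_mass[OF low_mass[OF assms(1,2)]] by (auto simp: le_fun_def)
  ultimately show ?thesis
    unfolding tail_up[OF assms(1,3)] by (auto simp: le_fun_def)
qed

lemma low_pow_mass: "\<delta> > 0 \<Longrightarrow> f \<in> mass_functions 1 \<Longrightarrow> (low \<delta> ^^ k) f \<in> mass_functions 1"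
  by (induction k) (auto simp del: comp_apply intro: low_mass simp: comp_apply[of "low \<delta>"])

lemma up_pow_mass: "\<delta> > 0 \<Longrightarrow> f \<in> mass_functions 1 \<Longrightarrow> (up \<delta> ^^ k) f \<in> mass_functions 1"
  by (induction k) (auto simp del: comp_apply intro: up_mass simp: comp_apply[of "up \<delta>"])

lemma tail_low_pow_mono:
  assumes "\<delta> > 0" "f \<in> mass_functions 1" "g \<in> mass_functions 1" "tail f \<le> tail g"
  shows "tail ((low \<delta> ^^ k) f) \<le> tail ((low \<delta> ^^ k) g)"
  by (induction k)
    (use assms in \<open>auto simp del: comp_apply intro!: tail_low_mono low_pow_mass simp: comp_apply[of "low \<delta>"]\<close>)

lemma tail_up_pow_mono:
  assumes "\<delta> > 0" "f \<in> mass_functions 1" "g \<in> mass_functions 1" "tail f \<le> tail g"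
  shows "tail ((up \<delta> ^^ k) f) \<le> tail ((up \<delta> ^^ k) g)"
  by (induction k)
    (use assms in \<open>auto simp del: comp_apply intro!: tail_up_mono up_pow_mass simp: comp_apply[of "up \<delta>"]\<close>)

text \<open>Cutting once by the total amount beforehand removes more than cutting step by step:
  after the long cut and an evolution of length \<open>n s\<close> the mass is already at most \<open>exp (- s)\<close>.\<close>

lemma tail_low_pow_ge:
  assumes s: "s > 0" and f: "f \<in> mass_functions 1"
  shows "tail (low (real (Suc n) * s) f) \<le> tail ((low s ^^ Suc n) f)"
proof (induction n)
  case 0
  show ?case by simp
next
  case (Suc n)
  note [measurable] = mass_functionsD(4)[OF f]
  let ?a = "real (Suc n) * s" and ?b = "real (Suc (Suc n)) * s"
  have pos: "?a > 0" "?b > 0"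
    by (intro mult_pos_pos s; simp)+
  have b: "?b = s + ?a" by (simp add: algebra_simps)
  let ?G = "\<lambda>r. min (ennreal (exp (- ?b))) (tail f r)"
  have "tail_evol ?a ?G \<le> tail (low ?a f)"
    unfolding tail_low[OF pos(1) f]
    by (intro tail_evol_mono le_funI min.mono) (use s in \<open>auto simp: b\<close>)
  moreover have "tail_evol ?a ?G \<le> tail_evol ?a (\<lambda>_. ennreal (exp (- ?b)))"
    by (intro tail_evol_mono le_funI) auto
  moreover have "tail_evol ?a (\<lambda>_. ennreal (exp (- ?b))) = (\<lambda>_. ennreal (exp (- s)))"
    unfolding tail_evol_const[OF pos(1)] b
    by (simp add: ennreal_mult'[symmetric] exp_add[symmetric])
  ultimately have "tail_evol ?a ?G \<le> (\<lambda>r. min (ennreal (exp (- s))) (tail (low ?a f) r))"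
    by (auto simp: le_fun_def)
  then have "tail_evol s (tail_evol ?a ?G) \<le> tail (low s (low ?a f))"
    unfolding tail_low[OF s low_mass[OF pos(1) f]] by (rule tail_evol_mono)
  moreover have "tail_evol s (tail_evol ?a ?G) = tail (low ?b f)"
    unfolding tail_low[OF pos(2) f] using tail_evol_add[OF s pos(1), of ?G] by (simp only: b) measurable
  moreover have "tail (low s (low ?a f)) \<le> tail (low s ((low s ^^ Suc n) f))"
    by (intro tail_low_mono s low_mass pos f low_pow_mass Suc.IH)
  ultimately show ?case
    by (simp only: funpow.simps(2)[of "Suc n"] comp_apply[of "low s"])
qed

text \<open>Omitting the intermediate cut can only raise the tail, and the semigroup property then
  merges the two evolutions into one.\<close>

lemma tail_up_pow_le:
  assumes s: "s > 0" and f: "f \<in> mass_functions 1"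
  shows "tail ((up s ^^ Suc n) f) \<le> tail (up (real (Suc n) * s) f)"
proof (induction n)
  case 0
  show ?case by simp
next
  case (Suc n)
  note [measurable] = mass_functionsD(4)[OF f]
  let ?a = "real (Suc n) * s" and ?b = "real (Suc (Suc n)) * s"
  have pos: "?a > 0" "?b > 0"
    by (intro mult_pos_pos s; simp)+
  have b: "?b = s + ?a" by (simp add: algebra_simps)
  have "tail (up s ((up s ^^ Suc n) f)) \<le> tail (up s (up ?a f))"
    by (intro tail_up_mono s up_mass pos f up_pow_mass Suc.IH)
  also have "\<dots> = (\<lambda>r. min 1 (tail_evol s (\<lambda>r. min 1 (tail_evol ?a (tail f) r)) r))"
    by (simp only: tail_up[OF s up_mass[OF pos(1) f]] tail_up[OF pos(1) f])
  also have "\<dots> \<le> (\<lambda>r. min 1 (tail_evol s (tail_evol ?a (tail f)) r))"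
    using tail_evol_mono[of "\<lambda>r. min 1 (tail_evol ?a (tail f) r)" "tail_evol ?a (tail f)" s]
    by (auto simp: le_fun_def intro: min.coboundedI2)
  also have "\<dots> = tail (up ?b f)"
    unfolding tail_up[OF pos(2) f] using tail_evol_add[OF s pos(1), of "tail f"] by (simp only: b) measurable
  finally show ?case
    by (simp only: funpow.simps(2)[of "Suc n"] comp_apply[of "up s"])
qed

section \<open>Comparison of the barriers with a common initial density\<close>

context
  fixes \<rho> :: "real \<Rightarrow> real"
  assumes \<rho>: "\<rho> \<in> mass_functions 1"
begin

lemma lower_mass: "\<delta> > 0 \<Longrightarrow> lower_barrier p \<rho> \<delta> k \<in> mass_functions 1"
  unfolding lower_barrier_def by (rule low_pow_mass[OF _ \<rho>])

lemma upper_mass: "\<delta> > 0 \<Longrightarrow> upper_barrier p \<rho> \<delta> k \<in> mass_functions 1"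
  unfolding upper_barrier_def by (rule up_pow_mass[OF _ \<rho>])

lemma lower_Suc: "lower_barrier p \<rho> \<delta> (Suc k) = low \<delta> (lower_barrier p \<rho> \<delta> k)"
  by (simp add: lower_barrier_def)

lemma upper_Suc: "upper_barrier p \<rho> \<delta> (Suc k) = up \<delta> (upper_barrier p \<rho> \<delta> k)"
  by (simp add: upper_barrier_def)

lemma lower_le_upper:
  assumes "\<delta> > 0"
  shows "tail (lower_barrier p \<rho> \<delta> k) \<le> tail (upper_barrier p \<rho> \<delta> k)"
proof (induction k)
  case 0
  show ?case by (simp add: lower_barrier_def upper_barrier_def)
next
  case (Suc k)
  then show ?case
    unfolding lower_Suc upper_Suc
    by (intro tail_low_le_up assms lower_mass upper_mass)
qed

text \<open>Each step of length \<delta> is first replaced by \<open>m\<close> short steps from the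
  same function; monotonicity of the short steps then carries the comparison accumulated so
  far.\<close>

lemma lower_refine:
  assumes "\<delta> > 0" "m > 0"
  shows "tail (lower_barrier p \<rho> \<delta> k) \<le> tail (lower_barrier p \<rho> (\<delta> / real m) (m * k))"
proof -
  define s where "s = \<delta> / real m"
  obtain n where m: "m = Suc n" using assms(2) by (cases m) auto
  have s: "s > 0" "\<delta> = real (Suc n) * s"
    using assms by (auto simp: s_def m)
  have "tail ((low \<delta> ^^ k) \<rho>) \<le> tail (((low s ^^ m) ^^ k) \<rho>)"
  proof (induction k)
    case (Suc k)
    let ?x = "(low \<delta> ^^ k) \<rho>" and ?y = "((low s ^^ m) ^^ k) \<rho>"
    have x: "?x \<in> mass_functions 1" by (rule low_pow_mass[OF assms(1) \<rho>])
    have y: "?y \<in> mass_functions 1" unfolding funpow_mult by (rule low_pow_mass[OF s(1) \<rho>])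
    have "tail (low \<delta> ?x) \<le> tail ((low s ^^ m) ?x)"
      unfolding m s(2) by (rule tail_low_pow_ge[OF s(1) x[unfolded s(2)]])
    also have "\<dots> \<le> tail ((low s ^^ m) ?y)"
      by (rule tail_low_pow_mono[OF s(1) x y Suc.IH])
    finally show ?case by (simp only: funpow.simps comp_apply[of "low \<delta>"] comp_apply[of "low s ^^ m"])
  qed simp
  then show ?thesis
    by (simp add: lower_barrier_def s_def funpow_mult)
qed

lemma upper_refine:
  assumes "\<delta> > 0" "m > 0"
  shows "tail (upper_barrier p \<rho> (\<delta> / real m) (m * k)) \<le> tail (upper_barrier p \<rho> \<delta> k)"
proof -
  define s where "s = \<delta> / real m"
  obtain n where m: "m = Suc n" using assms(2) by (cases m) auto
  have s: "s > 0" "\<delta> = real (Suc n) * s"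
    using assms by (auto simp: s_def m)
  have "tail (((up s ^^ m) ^^ k) \<rho>) \<le> tail ((up \<delta> ^^ k) \<rho>)"
  proof (induction k)
    case (Suc k)
    let ?x = "(up \<delta> ^^ k) \<rho>" and ?y = "((up s ^^ m) ^^ k) \<rho>"
    have x: "?x \<in> mass_functions 1" by (rule up_pow_mass[OF assms(1) \<rho>])
    have y: "?y \<in> mass_functions 1" unfolding funpow_mult by (rule up_pow_mass[OF s(1) \<rho>])
    have "tail ((up s ^^ m) ?y) \<le> tail ((up s ^^ m) ?x)"
      by (rule tail_up_pow_mono[OF s(1) y x Suc.IH])
    also have "\<dots> \<le> tail (up \<delta> ?x)"
      unfolding m s(2) by (rule tail_up_pow_le[OF s(1) x[unfolded s(2)]])
    finally show ?case by (simp only: funpow.simps comp_apply[of "up \<delta>"] comp_apply[of "up s ^^ m"])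
  qed simp
  then show ?thesis
    by (simp add: upper_barrier_def s_def funpow_mult)
qed

text \<open>Two subdivisions of the same time are compared through their common refinement into
  \<open>j * k\<close> steps.\<close>

lemma lower_le_upper_any:
  assumes "t > 0" "k > 0" "j > 0"
  shows "tail (lower_barrier p \<rho> (t / real k) k) \<le> tail (upper_barrier p \<rho> (t / real j) j)"
proof -
  have "tail (lower_barrier p \<rho> (t / real k) k) \<le> tail (lower_barrier p \<rho> (t / real k / real j) (j * k))"
    using assms by (intro lower_refine) auto
  also have "\<dots> \<le> tail (upper_barrier p \<rho> (t / real k / real j) (j * k))"
    using assms by (intro lower_le_upper) auto
  also have "\<dots> = tail (upper_barrier p \<rho> (t / real j / real k) (k * j))"
    by (simp add: mult.commute)
  also have "\<dots> \<le> tail (upper_barrier p \<rho> (t / real j) j)"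
    using assms by (intro upper_refine) auto
  finally show ?thesis .
qed

lemma barriers_L1:
  assumes \<delta>: "\<delta> > 0"
  shows "(LINT x|lborel. \<bar>lower_barrier p \<rho> \<delta> k x - upper_barrier p \<rho> \<delta> k x\<bar>)
    \<le> 4 * exp (real k * \<delta>) * \<delta>"
proof -
  let ?l = "lower_barrier p \<rho> \<delta>" and ?u = "upper_barrier p \<rho> \<delta>"
  define w where "w k = (\<lambda>x. exp \<delta> * Cminus \<delta> (?l k) x)" for k
  have w: "w k \<in> mass_functions 1" for k
    using mass_functionsD[OF Cminus_mass[OF \<delta> lower_mass[OF \<delta>]]]
    by (simp add: w_def mass_functions_def exp_minus)
  have w_close: "(LINT x|lborel. \<bar>w k x - ?l k x\<bar>) \<le> 2 * \<delta>" for k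
    using scaled_cut_L1[OF lower_mass[OF \<delta>] \<delta>] by (simp add: w_def Cminus_def)
  \<comment> \<open>Moving the factor \<open>exp \<delta>\<close> out through the evolution and then
    through the cut changes the cut mass from 1 to \<open>exp (- \<delta>)\<close>, which is the
    lower cut of the next function.\<close>
  have w_Suc: "w (Suc k) = up \<delta> (w k)" for k
  proof -
    have "up \<delta> (w k) = cut 1 (\<lambda>x. exp \<delta> * low \<delta> (?l k) x)"
      by (simp add: Cplus_def w_def Tstar_cmult)
    also have "\<dots> = w (Suc k)"
      by (simp only: cut_cmult[OF exp_gt_zero] w_def lower_Suc Cminus_def) (simp add: exp_minus divide_inverse)
    finally show ?thesis ..
  qed
  \<comment> \<open>At \<open>k = 0\<close> the upper barrier is still \<rho> itself, so the initial
    error is that of one rescaled cut. Afterwards the evolution costs a factor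
    \<open>exp \<delta>\<close> and the cut costs nothing.\<close>
  have wu: "(LINT x|lborel. \<bar>w k x - ?u k x\<bar>) \<le> exp (real k * \<delta>) * (2 * \<delta>)"
  proof (induction k)
    case 0
    show ?case using w_close[of 0] by (simp add: lower_barrier_def upper_barrier_def)
  next
    case (Suc k)
    have "(LINT x|lborel. \<bar>w (Suc k) x - ?u (Suc k) x\<bar>)
        = (LINT x|lborel. \<bar>cut 1 (Tstar p \<delta> (w k)) x - cut 1 (Tstar p \<delta> (?u k)) x\<bar>)"
      by (simp add: w_Suc upper_Suc Cplus_def)
    also have "\<dots> \<le> (LINT x|lborel. \<bar>Tstar p \<delta> (w k) x - Tstar p \<delta> (?u k) x\<bar>)"
      using \<delta> by (intro cut_L1[OF Tstar_mass[OF \<delta> w] Tstar_mass[OF \<delta> upper_mass[OF \<delta>]]]) auto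
    also have "\<dots> \<le> exp \<delta> * (LINT x|lborel. \<bar>w k x - ?u k x\<bar>)"
      by (rule Tstar_L1[OF \<delta> w upper_mass[OF \<delta>]])
    also have "\<dots> \<le> exp \<delta> * (exp (real k * \<delta>) * (2 * \<delta>))"
      using Suc.IH by simp
    also have "\<dots> = exp (real (Suc k) * \<delta>) * (2 * \<delta>)"
      by (simp add: exp_add distrib_right)
    finally show ?case .
  qed
  note i = mass_functionsD(1)[OF w] mass_functionsD(1)[OF lower_mass[OF \<delta>]]
    mass_functionsD(1)[OF upper_mass[OF \<delta>]]
  have "(LINT x|lborel. \<bar>?l k x - ?u k x\<bar>)
      \<le> (LINT x|lborel. \<bar>w k x - ?l k x\<bar> + \<bar>w k x - ?u k x\<bar>)"
    by (rule integral_mono) (use i in auto)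
  also have "\<dots> = (LINT x|lborel. \<bar>w k x - ?l k x\<bar>) + (LINT x|lborel. \<bar>w k x - ?u k x\<bar>)"
    by (rule Bochner_Integration.integral_add) (use i in auto)
  \<comment> \<open>The constant 4 collects \<open>2 * \<delta>\<close> for passing from the lower
    barrier to \<open>w\<close> and the factor 2 in the propagated error.\<close>
  also have "\<dots> \<le> 2 * \<delta> + exp (real k * \<delta>) * (2 * \<delta>)"
    by (rule add_mono[OF w_close wu])
  also have "\<dots> \<le> exp (real k * \<delta>) * (2 * \<delta>) + exp (real k * \<delta>) * (2 * \<delta>)"
    using \<delta> by simp
  finally show ?thesis by (simp add: mult_ac)
qed

text \<open>A cut does not raise the supremum and the evolution multiplies it by at most
  \<open>exp \<delta>\<close>. The bound depends only on the elapsed time, hence is uniform over all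
  subdivisions of it.\<close>

lemma lower_bounded:
  assumes \<delta>: "\<delta> > 0" and M: "\<And>x. \<rho> x \<le> M" "M \<ge> 0"
  shows "lower_barrier p \<rho> \<delta> k x \<le> exp (real k * \<delta>) * M"
proof (induction k arbitrary: x)
  case 0
  show ?case using M by (simp add: lower_barrier_def)
next
  case (Suc k)
  note c = mass_functionsD[OF Cminus_mass[OF \<delta> lower_mass[OF \<delta>, of k]]]
  have "Cminus \<delta> (lower_barrier p \<rho> \<delta> k) y \<le> exp (real k * \<delta>) * M" for y
    using Suc.IH cut_le[of "lower_barrier p \<rho> \<delta> k" y] mass_functionsD(2)[OF lower_mass[OF \<delta>]]
    unfolding Cminus_def by (meson order.trans)
  then have "Tstar p \<delta> (Cminus \<delta> (lower_barrier p \<rho> \<delta> k)) x \<le> exp \<delta> * (exp (real k * \<delta>) * M)"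
    using M by (intro Tstar_le \<delta> c) auto
  then show ?case
    by (simp add: lower_Suc exp_add distrib_right mult.assoc)
qed

end

end

section \<open>The function between the barriers\<close>

lemma tail_tendsto_0:
  assumes v: "v \<in> mass_functions a"
  shows "((\<lambda>r. enn2real (tail v r)) \<longlongrightarrow> 0) at_top"
proof -
  have "enn2real (tail v r) = a - cdf (dens v) r" for r
    using mass_functionsD(2)[OF v]
    by (simp add: tail_eq_ennreal[OF v] tail_eq_cdf[OF v, symmetric] set_lebesgue_integral_def)
  moreover have "((\<lambda>r. a - cdf (dens v) r) \<longlongrightarrow> a - a) at_top"
    by (intro tendsto_intros cdf_dens_at_top[OF v])
  ultimately show ?thesis by simp
qed

lemma tail_Lipschitz:
  assumes [measurable]: "v \<in> borel_measurable borel"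
    and "\<And>x. v x \<le> c" "c \<ge> 0" "a \<le> b"
  shows "tail v a \<le> tail v b + ennreal (c * (b - a))"
proof -
  have "tail v a \<le> (\<integral>\<^sup>+ x. ennreal (v x) * indicator {b..} x + ennreal c * indicator {a..<b} x \<partial>lborel)"
    unfolding tail_nn_integral[OF assms(1)]
    by (intro nn_integral_mono) (use assms in \<open>auto simp: indicator_def intro: ennreal_leI\<close>)
  also have "\<dots> = tail v b + ennreal c * ennreal (b - a)"
    using assms by (simp add: nn_integral_add tail_nn_integral nn_integral_cmult)
  finally show ?thesis using assms by (simp add: ennreal_mult')
qed

text \<open>Closed right half-lines are stable under intersection, generate the Borel sets and have
  finite mass, so equal tails force equal measures and hence densities equal almost
  everywhere.\<close>

lemma tail_eq_imp_AE_eq: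
  assumes f: "f \<in> mass_functions a" and g: "g \<in> mass_functions b" and eq: "tail f = tail g"
  shows "AE x in lborel. f x = g x"
proof -
  have "dens f = dens g"
  proof (rule measure_eqI_generator_eq[where E="range (\<lambda>r::real. {r..})" and \<Omega>=UNIV and A="\<lambda>i. {- real i..}"])
    have "{a..} \<inter> {b..} = {max a b..}" for a b :: real by auto
    then show "Int_stable (range (\<lambda>r::real. {r..}))"
      by (auto simp: Int_stable_def)
    show "(\<Union>i. {- real i..}) = UNIV"
      by auto (metis minus_le_iff real_arch_simple)
    show "emeasure (dens f) {- real i..} \<noteq> \<infinity>" for i
      using tail_le_mass[OF f, of "- real i"] by (auto simp: tail_def top_unique)
  qed (use eq in \<open>auto simp: tail_def fun_eq_iff dens_def borel_Ici\<close>)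
  then have "AE x in lborel. ennreal (f x) = ennreal (g x)"
    unfolding dens_def
    by (intro sigma_finite_measure.density_unique[OF lborel.sigma_finite_measure_axioms]) (use mass_functionsD(4)[OF f] mass_functionsD(4)[OF g] in auto)
  then show ?thesis
    by eventually_elim (use mass_functionsD(2)[OF f] mass_functionsD(2)[OF g] in auto)
qed

text \<open>The set function \<open>S\<close> is a measure that agrees with the Stieltjes measure of
  the sum on half-open intervals. The lemma serves to obtain domination of measures from a
  decomposition of a distribution function.\<close>

lemma interval_measure_add:
  assumes F: "\<And>x y. x \<le> y \<Longrightarrow> F x \<le> F y" "\<And>a. continuous (at_right a) F"
    and G: "\<And>x y. x \<le> y \<Longrightarrow> G x \<le> G y" "\<And>a. continuous (at_right a) G"
    and A: "A \<in> sets borel"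
  shows "emeasure (interval_measure F) A + emeasure (interval_measure G) A
    = emeasure (interval_measure (\<lambda>x. F x + G x)) A"
proof -
  define S where "S = measure_of UNIV (sets borel)
    (\<lambda>A. emeasure (interval_measure F) A + emeasure (interval_measure G) A)"
  have sets_S: "sets S = sets borel"
    using sets.sigma_sets_eq[of "borel :: real measure"] by (simp add: S_def)
  have S: "emeasure S A = emeasure (interval_measure F) A + emeasure (interval_measure G) A"
    if "A \<in> sets borel" for A
  proof (rule emeasure_measure_of[OF S_def])
    show "countably_additive (sets S)
      (\<lambda>A. emeasure (interval_measure F) A + emeasure (interval_measure G) A)"
      unfolding countably_additive_def
    proof (intro allI impI)
      fix B :: "nat \<Rightarrow> real set"
      assume "range B \<subseteq> sets S" "disjoint_family B"
      then show "(\<Sum>i. emeasure (interval_measure F) (B i) + emeasure (interval_measure G) (B i))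
         = emeasure (interval_measure F) (\<Union>i. B i) + emeasure (interval_measure G) (\<Union>i. B i)"
        by (subst suminf_add[symmetric]) (auto simp: suminf_emeasure sets_S)
    qed
  qed (auto simp: positive_def sets_S that)
  have Ioc: "emeasure S {a<..b} = emeasure (interval_measure (\<lambda>x. F x + G x)) {a<..b}" for a b
  proof (cases "a \<le> b")
    case True
    then show ?thesis
      using F G
      by (simp add: S emeasure_interval_measure_Ioc_eq add_mono continuous_add ennreal_plus[symmetric]
          del: ennreal_plus)
  qed simp
  have "S = interval_measure (\<lambda>x. F x + G x)"
  proof (rule measure_eqI_generator_eq[where E="range (\<lambda>(a, b). {a<..b::real})" and \<Omega>=UNIV
        and A="\<lambda>i. {- real i<..real i}"])
    show "(\<Union>i. {- real (i::nat)<..real i}) = UNIV"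
      by (rule UN_Ioc_eq_UNIV)
    show "emeasure S {- real i<..real i} \<noteq> \<infinity>" for i
      using F G by (simp add: Ioc emeasure_interval_measure_Ioc_eq add_mono continuous_add)
  qed (auto simp: Ioc sets_S borel_sigma_sets_Ioc Int_stable_def)
  then show ?thesis
    using S[OF A] by simp
qed

text \<open>The Stieltjes measure of \<open>- F\<close> is dominated by \<open>c\<close> times
  Lebesgue measure, so Radon--Nikodym gives a density. The limit at infinity identifies its tails
  and the bound \<open>m\<close> makes it integrable.\<close>

lemma Lipschitz_tail_density:
  fixes F :: "real \<Rightarrow> real"
  assumes mono: "\<And>x y. x \<le> y \<Longrightarrow> F y \<le> F x"
    and lip: "\<And>x y. x \<le> y \<Longrightarrow> F x \<le> F y + c * (y - x)"
    and lim: "(F \<longlongrightarrow> 0) at_top" and bdd: "\<And>x. F x \<le> m"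
  shows "\<exists>v a. v \<in> mass_functions a \<and> tail v = (\<lambda>r. ennreal (F r))"
proof -
  have c: "c \<ge> 0" using lip[of 0 1] mono[of 0 1] by simp
  have "c-lipschitz_on UNIV F"
  proof (rule lipschitz_onI)
    fix x y :: real
    show "dist (F x) (F y) \<le> c * dist x y"
      using lip[of x y] lip[of y x] mono[of x y] mono[of y x]
      by (cases "x \<le> y") (auto simp: dist_real_def abs_if algebra_simps)
  qed (rule c)
  then have cont: "continuous_on UNIV F" by (rule lipschitz_on_continuous_on)
  then have contr: "continuous (at_right a) F" for a
    by (simp add: continuous_on_eq_continuous_at continuous_at_imp_continuous_at_within)
  define \<nu> where "\<nu> = interval_measure (\<lambda>x. - F x)"
  \<comment> \<open>The Lipschitz bound makes \<open>c * x + F x\<close> nondecreasing; its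
    Stieltjes measure is what must be added to \<nu> to reach that of \<open>c * x\<close>.\<close>
  have \<nu>_le: "emeasure \<nu> A \<le> emeasure (interval_measure (\<lambda>x. c * x)) A" if "A \<in> sets borel" for A
  proof -
    have "emeasure \<nu> A + emeasure (interval_measure (\<lambda>x. c * x + F x)) A
      = emeasure (interval_measure (\<lambda>x. - F x + (c * x + F x))) A"
      unfolding \<nu>_def
    proof (rule interval_measure_add)
      show "c * x + F x \<le> c * y + F y" if "x \<le> y" for x y
        using lip[OF that] by (simp add: right_diff_distrib)
      show "continuous (at_right a) (\<lambda>x. - F x)" "continuous (at_right a) (\<lambda>x. c * x + F x)" for a
        by (intro continuous_intros contr)+
    qed (use mono that in auto)
    then have "emeasure (interval_measure (\<lambda>x. c * x)) A
      = emeasure \<nu> A + emeasure (interval_measure (\<lambda>x. c * x + F x)) A"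
      by simp
    then show ?thesis by simp
  qed
  have "absolutely_continuous lborel \<nu>"
    unfolding absolutely_continuous_def
  proof
    fix A :: "real set" assume A: "A \<in> null_sets lborel"
    have "interval_measure (\<lambda>x. c * x) = density lborel (\<lambda>_. ennreal c)"
    proof (rule measure_eqI_generator_eq[where E="range (\<lambda>(a, b). {a<..b::real})" and \<Omega>=UNIV
        and A="\<lambda>i. {- real i<..real i}"])
      show "(\<Union>i. {- real (i::nat)<..real i}) = UNIV"
        by (rule UN_Ioc_eq_UNIV)
      have *: "emeasure (interval_measure (\<lambda>x. c * x)) {a<..b} = (if a \<le> b then ennreal (c * (b - a)) else 0)" for a b
        by (subst emeasure_interval_measure_Ioc_eq)
          (use c in \<open>auto simp: mult_left_mono right_diff_distrib intro: continuous_mult_left\<close>)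
      show "emeasure (interval_measure (\<lambda>x. c * x)) {- real i<..real i} \<noteq> \<infinity>" for i
        by (simp add: *)
      show "emeasure (interval_measure (\<lambda>x. c * x)) X = emeasure (density lborel (\<lambda>_. ennreal c)) X"
        if "X \<in> range (\<lambda>(a, b). {a<..b})" for X
        using that c by (auto simp: * emeasure_density_const ennreal_mult')
    qed (auto simp: borel_sigma_sets_Ioc Int_stable_def)
    then have "emeasure \<nu> A \<le> ennreal c * emeasure lborel A"
      using \<nu>_le[of A] A by (auto simp: emeasure_density_const null_sets_def)
    then show "A \<in> null_sets \<nu>"
      using A by (auto simp: null_sets_def \<nu>_def)
  qed
  then obtain f where f [measurable]: "f \<in> borel_measurable lborel" and f\<nu>: "density lborel f = \<nu>"
    using sigma_finite_measure.Radon_Nikodym[OF lborel.sigma_finite_measure_axioms, of \<nu>] by (auto simp: \<nu>_def)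
  \<comment> \<open>The half-line is exhausted by the intervals from \<open>r\<close> to
    \<open>r + n\<close>, whose measure is \<open>F r - F (r + n)\<close> with the last term tending
    to 0.\<close>
  have tail: "emeasure \<nu> {r..} = ennreal (F r)" for r
  proof (rule LIMSEQ_unique)
    have "(\<lambda>n. emeasure \<nu> {r..r + real n}) \<longlonglongrightarrow> emeasure \<nu> (\<Union>n. {r..r + real n})"
      by (rule Lim_emeasure_incseq) (auto simp: incseq_def \<nu>_def)
    moreover have "(\<Union>n. {r..r + real n}) = {r..}"
      by auto (metis add.commute diff_le_eq real_arch_simple)
    ultimately show "(\<lambda>n. emeasure \<nu> {r..r + real n}) \<longlonglongrightarrow> emeasure \<nu> {r..}" by simp
    have "filterlim (\<lambda>n. r + real n) at_top sequentially"
      by (intro filterlim_tendsto_add_at_top[OF tendsto_const] filterlim_real_sequentially)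
    then have "(\<lambda>n. F (r + real n)) \<longlonglongrightarrow> 0"
      by (rule filterlim_compose[OF lim])
    then have "(\<lambda>n. ennreal (F r - F (r + real n))) \<longlonglongrightarrow> ennreal (F r - 0)"
      by (intro tendsto_ennrealI tendsto_intros)
    moreover have "emeasure \<nu> {r..r + real n} = ennreal (F r - F (r + real n))" for n
      unfolding \<nu>_def by (subst emeasure_interval_measure_Icc)
        (use mono cont in \<open>auto intro!: continuous_intros\<close>)
    ultimately show "(\<lambda>n. emeasure \<nu> {r..r + real n}) \<longlonglongrightarrow> ennreal (F r)" by simp
  qed
  have "emeasure \<nu> (\<Union>n. {- real n..}) = (SUP n. emeasure \<nu> {- real n..})"
    by (rule SUP_emeasure_incseq[symmetric]) (auto simp: incseq_def \<nu>_def)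
  also have "\<dots> \<le> ennreal m"
    by (intro SUP_least) (auto simp: tail intro!: ennreal_leI bdd)
  also have "(\<Union>n. {- real n..}) = UNIV"
    by auto (metis minus_le_iff real_arch_simple)
  finally have "emeasure \<nu> UNIV < \<infinity>"
    by (simp add: order.strict_trans1)
  then have fin: "(\<integral>\<^sup>+ x. f x \<partial>lborel) < \<infinity>"
    by (simp add: f\<nu>[symmetric] emeasure_density)
  \<comment> \<open>Finite total mass makes the \<open>ennreal\<close>-valued density finite almost
    everywhere, so its real part represents the same measure.\<close>
  then have ae: "AE x in lborel. ennreal (enn2real (f x)) = f x"
    using nn_integral_PInf_AE[OF f] by (auto simp: top.not_eq_extremum)
  then have int: "(\<integral>\<^sup>+ x. ennreal (enn2real (f x)) \<partial>lborel) = (\<integral>\<^sup>+ x. f x \<partial>lborel)"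
    by (rule nn_integral_cong_AE)
  have "(\<lambda>x. enn2real (f x)) \<in> mass_functions (enn2real (\<integral>\<^sup>+ x. f x \<partial>lborel))"
    by (rule mass_functionsI) (use fin int in \<open>auto\<close>)
  moreover have "dens (\<lambda>x. enn2real (f x)) = \<nu>"
    unfolding dens_def f\<nu>[symmetric] using ae by (intro density_cong) auto
  then have "tail (\<lambda>x. enn2real (f x)) = (\<lambda>r. ennreal (F r))"
    by (simp add: fun_eq_iff tail_def tail)
  ultimately show ?thesis by blast
qed

section \<open>Uniqueness and existence of the separating function\<close>

context jump_kernel
begin

context
  fixes \<rho> :: "real \<Rightarrow> real"
  assumes \<rho>: "\<rho> \<in> mass_functions 1"
begin

lemma nn_L1_barriers:
  assumes \<delta>: "\<delta> > 0"
  shows "(\<integral>\<^sup>+ r. ennreal \<bar>lower_barrier p \<rho> \<delta> k r - upper_barrier p \<rho> \<delta> k r\<bar> \<partial>lborel)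
    \<le> ennreal (4 * exp (real k * \<delta>) * \<delta>)"
proof -
  have "(\<integral>\<^sup>+ r. ennreal \<bar>lower_barrier p \<rho> \<delta> k r - upper_barrier p \<rho> \<delta> k r\<bar> \<partial>lborel)
    = ennreal (LINT r|lborel. \<bar>lower_barrier p \<rho> \<delta> k r - upper_barrier p \<rho> \<delta> k r\<bar>)"
    using mass_functionsD(1)[OF lower_mass[OF \<rho> \<delta>]] mass_functionsD(1)[OF upper_mass[OF \<rho> \<delta>]]
    by (intro nn_integral_eq_integral) auto
  then show ?thesis
    using barriers_L1[OF \<rho> \<delta>] by (simp add: ennreal_leI)
qed

text \<open>Pointwise, the upper barrier is at most the lower one plus their distance; thus the L1
  bound controls the tail gap uniformly in \<open>r\<close>.\<close>

lemma upper_le_lower_add: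
  assumes \<delta>: "\<delta> > 0"
  shows "tail (upper_barrier p \<rho> \<delta> k) r
    \<le> tail (lower_barrier p \<rho> \<delta> k) r + ennreal (4 * exp (real k * \<delta>) * \<delta>)"
proof -
  let ?l = "lower_barrier p \<rho> \<delta> k" and ?u = "upper_barrier p \<rho> \<delta> k"
  note ml = mass_functionsD[OF lower_mass[OF \<rho> \<delta>]]
  note mu = mass_functionsD[OF upper_mass[OF \<rho> \<delta>]]
  note [measurable] = ml(4) mu(4)
  have "tail ?u r \<le> (\<integral>\<^sup>+ x. ennreal (?l x) * indicator {r..} x + ennreal \<bar>?l x - ?u x\<bar> \<partial>lborel)"
    unfolding tail_nn_integral[OF mu(4)]
    by (intro nn_integral_mono)
      (use ml(2) in \<open>auto simp: indicator_def ennreal_plus[symmetric] intro!: ennreal_leI simp del: ennreal_plus\<close>)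
  also have "\<dots> = tail ?l r + (\<integral>\<^sup>+ x. ennreal \<bar>?l x - ?u x\<bar> \<partial>lborel)"
    by (simp add: nn_integral_add tail_nn_integral)
  also have "\<dots> \<le> tail ?l r + ennreal (4 * exp (real k * \<delta>) * \<delta>)"
    by (intro add_left_mono nn_L1_barriers \<delta>)
  finally show ?thesis .
qed

text \<open>With \<open>2 ^ n\<close> steps of length \<open>t / 2 ^ n\<close>, \<open>u'\<close>
  lies below the upper barrier and \<open>u\<close> above the lower one, and the gap
  \<open>4 * exp t * (t / 2 ^ n)\<close> vanishes. Exchanging the roles gives the reverse
  inequality.\<close>

lemma between_barriers_tl_unique:
  assumes u: "between_barriers p \<rho> u" and u': "between_barriers p \<rho> u'" and t: "t > 0"
  shows "tail (\<lambda>r. u' r t) \<le> tail (\<lambda>r. u r t)"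
proof (rule le_funI, rule LIMSEQ_le_const)
  fix r
  let ?e = "\<lambda>n. 4 * exp t * (t / 2 ^ n)"
  have "(\<lambda>n. ?e n) \<longlonglongrightarrow> 4 * exp t * 0"
    by (intro tendsto_mult tendsto_const LIMSEQ_divide_realpow_zero) auto
  then have "(\<lambda>n. tail (\<lambda>r. u r t) r + ennreal (?e n)) \<longlonglongrightarrow> tail (\<lambda>r. u r t) r + ennreal 0"
    by (intro tendsto_add tendsto_const tendsto_ennrealI) simp
  then show "(\<lambda>n. tail (\<lambda>r. u r t) r + ennreal (?e n)) \<longlonglongrightarrow> tail (\<lambda>r. u r t) r"
    by simp
  have "tail (\<lambda>r. u' r t) r \<le> tail (\<lambda>r. u r t) r + ennreal (?e n)" for n
  proof -
    let ?d = "t / 2 ^ n" and ?k = "2 ^ n :: nat"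
    have d: "?d > 0" "?k > 0" "real ?k * ?d = t" using t by auto
    have "tail (\<lambda>r. u' r t) \<le> tail (upper_barrier p \<rho> ?d ?k)"
      using u' d unfolding between_barriers_def tail_le_iff by metis
    moreover have "tail (lower_barrier p \<rho> ?d ?k) \<le> tail (\<lambda>r. u r t)"
      using u d unfolding between_barriers_def tail_le_iff by metis
    ultimately have "tail (\<lambda>r. u' r t) r \<le> tail (upper_barrier p \<rho> ?d ?k) r"
        and "tail (lower_barrier p \<rho> ?d ?k) r \<le> tail (\<lambda>r. u r t) r"
      by (auto dest: le_funD)
    then show ?thesis
      using upper_le_lower_add[OF d(1), of ?k r] unfolding d(3)
      by (meson add_right_mono order.trans)
  qed
  then show "\<exists>N. \<forall>n\<ge>N. tail (\<lambda>r. u' r t) r \<le> tail (\<lambda>r. u r t) r + ennreal (?e n)"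
    by blast
qed

lemma between_barriers_unique:
  assumes u: "between_barriers p \<rho> u" and u': "between_barriers p \<rho> u'" and t: "t > 0"
  shows "AE r in lborel. u' r t = u r t"
proof (rule tail_eq_imp_AE_eq)
  show "(\<lambda>r. u r t) \<in> mass_functions (LINT r|lborel. u r t)"
    "(\<lambda>r. u' r t) \<in> mass_functions (LINT r|lborel. u' r t)"
    using u u' t by (simp_all add: between_barriers_def mass_functions_def)
  show "tail (\<lambda>r. u' r t) = tail (\<lambda>r. u r t)"
    using between_barriers_tl_unique[OF u u' t] between_barriers_tl_unique[OF u' u t]
    by (rule order.antisym)
qed

lemma between_exists_at:
  assumes M: "\<And>x. \<rho> x \<le> M" and t: "t > 0"
  shows "\<exists>v a. v \<in> mass_functions a \<and>
    (\<forall>k>0. tail (lower_barrier p \<rho> (t / real k) k) \<le> tail v \<and> tail v \<le> tail (upper_barrier p \<rho> (t / real k) k))"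
proof -
  define L where "L k = lower_barrier p \<rho> (t / real k) k" for k :: nat
  \<comment> \<open>The candidate tail is the least one above all lower barriers at time
    \<open>t\<close>; the index 0 is excluded because it corresponds to no subdivision.\<close>
  define S where "S r = (SUP k\<in>{0<..}. tail (L k) r)" for r
  define c where "c = exp t * M"
  have M0: "M \<ge> 0" using M[of 0] mass_functionsD(2)[OF \<rho>, of 0] by linarith
  \<comment> \<open>Every subdivision of \<open>t\<close> gives the same bound \<open>c\<close>, so
    the Lipschitz estimate of the tails survives the supremum.\<close>
  have L: "L k \<in> mass_functions 1" "\<And>x. L k x \<le> c" if "k > 0" for k
    using lower_mass[OF \<rho>, of "t / real k" k] lower_bounded[OF \<rho> _ M M0, of "t / real k" k] that t
    by (auto simp: L_def c_def)
  have S_le_upper: "S r \<le> tail (upper_barrier p \<rho> (t / real k) k) r" if "k > 0" for r k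
    unfolding S_def L_def
    by (intro SUP_least le_funD[OF lower_le_upper_any[OF \<rho> t]]) (use that in auto)
  have S_le: "S r \<le> 1" for r
    unfolding S_def by (intro SUP_least) (use tail_le_mass[OF L(1)] in auto)
  then have fin: "S r < top" for r
    by (metis ennreal_one_less_top order.strict_trans1)
  then have S: "ennreal (enn2real (S r)) = S r" for r
    by simp
  have "\<exists>v a. v \<in> mass_functions a \<and> tail v = (\<lambda>r. ennreal (enn2real (S r)))"
  proof (rule Lipschitz_tail_density)
    fix x y :: real assume xy: "x \<le> y"
    have "S y \<le> S x"
      unfolding S_def by (intro SUP_mono) (use tail_antimono[OF xy] in auto)
    then show "enn2real (S y) \<le> enn2real (S x)"
      by (rule enn2real_mono) (rule fin)
    have "S x \<le> S y + ennreal (c * (y - x))"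
      unfolding S_def[of x]
    proof (rule SUP_least)
      fix k :: nat assume k: "k \<in> {0<..}"
      then have "tail (L k) x \<le> tail (L k) y + ennreal (c * (y - x))"
        using L[of k] M0 xy by (intro tail_Lipschitz mass_functionsD(4)[OF L(1)]) (auto simp: c_def)
      also have "\<dots> \<le> S y + ennreal (c * (y - x))"
        unfolding S_def by (intro add_right_mono SUP_upper k)
      finally show "tail (L k) x \<le> S y + ennreal (c * (y - x))" .
    qed
    also have "\<dots> = ennreal (enn2real (S y) + c * (y - x))"
      using xy M0 by (simp add: S c_def)
    finally show "enn2real (S x) \<le> enn2real (S y) + c * (y - x)"
      using xy M0 by (intro enn2real_leI) (auto simp: c_def)
  next
    \<comment> \<open>Decay at infinity is inherited from a single upper barrier; the one with one
      step suffices.\<close>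
    have "((\<lambda>r. enn2real (tail (upper_barrier p \<rho> (t / real 1) 1) r)) \<longlongrightarrow> 0) at_top"
      by (rule tail_tendsto_0[OF upper_mass[OF \<rho>]]) (use t in simp)
    then show "((\<lambda>r. enn2real (S r)) \<longlongrightarrow> 0) at_top"
    proof (rule tendsto_sandwich[rotated 3, where f="\<lambda>_. 0"])
      have "enn2real (S r) \<le> enn2real (tail (upper_barrier p \<rho> (t / real 1) 1) r)" for r
        using S_le_upper[of 1 r] tail_le_mass[OF upper_mass[OF \<rho>], of "t / real 1" 1 r] t
        by (intro enn2real_mono) (auto intro: order.strict_trans1)
      then show "\<forall>\<^sub>F r in at_top. enn2real (S r) \<le> enn2real (tail (upper_barrier p \<rho> (t / real 1) 1) r)"
        by simp
    qed auto
  next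
    show "enn2real (S x) \<le> 1" for x
      using S_le[of x] by (intro enn2real_leI) auto
  qed
  then obtain v a where v: "v \<in> mass_functions a" "tail v = S"
    by (auto simp: S)
  have "tail (L k) \<le> S" if "k > 0" for k
    unfolding S_def by (intro le_funI SUP_upper) (use that in simp)
  then have "\<forall>k>0. tail (lower_barrier p \<rho> (t / real k) k) \<le> tail v
      \<and> tail v \<le> tail (upper_barrier p \<rho> (t / real k) k)"
    using S_le_upper by (auto simp: v(2) L_def intro: le_funI)
  with v(1) show ?thesis by blast
qed

text \<open>The conditions at different times are independent, so a density is chosen for each
  \<open>t\<close> separately. The pair (\<delta>, \<open>k\<close>) is then the subdivision of
  \<open>k * \<delta>\<close> into \<open>k\<close> steps.\<close>

lemma between_barriers_exists:
  assumes M: "\<And>x. \<rho> x \<le> M"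
  shows "\<exists>u. between_barriers p \<rho> u"
proof -
  have "\<forall>t. \<exists>v. t > 0 \<longrightarrow> (\<exists>a. v \<in> mass_functions a) \<and>
    (\<forall>k>0. tail (lower_barrier p \<rho> (t / real k) k) \<le> tail v \<and> tail v \<le> tail (upper_barrier p \<rho> (t / real k) k))"
    using between_exists_at[OF M] by blast
  from choice[OF this] obtain v where v: "\<And>t. t > 0 \<Longrightarrow> \<exists>a. v t \<in> mass_functions a"
    "\<And>t k. t > 0 \<Longrightarrow> k > 0 \<Longrightarrow> tail (lower_barrier p \<rho> (t / real k) k) \<le> tail (v t)
      \<and> tail (v t) \<le> tail (upper_barrier p \<rho> (t / real k) k)"
    by blast
  have "between_barriers p \<rho> (\<lambda>r t. v t r)"
    unfolding between_barriers_def tail_le_iff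
  proof (intro conjI allI impI)
    fix \<delta> :: real and k :: nat
    assume "\<delta> > 0" "k > 0"
    then show "tail (lower_barrier p \<rho> \<delta> k) \<le> tail (\<lambda>r. v (real k * \<delta>) r)"
      "tail (\<lambda>r. v (real k * \<delta>) r) \<le> tail (upper_barrier p \<rho> \<delta> k)"
      using v(2)[of "real k * \<delta>" k] by auto
  next
    fix t :: real assume "t > 0"
    then obtain a where "v t \<in> mass_functions a" using v(1) by blast
    then show "integrable lborel (\<lambda>r. v t r)" "0 \<le> v t r" for r
      by (auto dest: mass_functionsD)
  qed
  then show ?thesis by blast
qed

end

end

lemma smooth_bounded_support_le:
  assumes "smooth f" "\<And>x. \<bar>x\<bar> > A \<Longrightarrow> f x = 0"
  obtains M where "\<And>x. f x \<le> M"
proof -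
  have "isCont f x" for x
    using assms(1)[unfolded smooth_def, rule_format, of 0 x]
    by (auto dest: field_differentiable_imp_continuous_at)
  then have "continuous_on {-A..A} f"
    by (intro continuous_at_imp_continuous_on) auto
  then have "bounded (f ` {-A..A})"
    by (intro compact_imp_bounded compact_continuous_image) auto
  then obtain B where B: "\<And>x. x \<in> {-A..A} \<Longrightarrow> \<bar>f x\<bar> \<le> B"
    unfolding bounded_iff by fastforce
  have "f x \<le> max B 0" for x
  proof (cases "\<bar>x\<bar> > A")
    case False
    then have "x \<in> {-A..A}" by auto
    from abs_le_D1[OF B[OF this]] show ?thesis by simp
  qed (use assms(2) in auto)
  then show ?thesis by (rule that)
qed

theorem theorem3p3:
  fixes \<rho>0 :: "real \<Rightarrow> real" and p :: "real \<Rightarrow> real \<Rightarrow> real" and A \<xi> :: real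
  assumes "A > 0"
    and "\<rho>0 \<in> mass_functions 1"
    and "smooth \<rho>0"
    and "\<And>x. \<bar>x\<bar> > A \<Longrightarrow> \<rho>0 x = 0"
    and "\<xi> > 0"
    and "\<And>x y. p x y = p 0 (y - x)"
    and "\<And>x. p x \<in> mass_functions 1"
    and "smooth (p 0)"
    and "\<And>x. \<bar>x\<bar> \<ge> \<xi> \<Longrightarrow> p 0 x = 0"
  shows
    "(\<forall>\<delta>>0. \<forall>k>0.
        dens (lower_barrier p \<rho>0 \<delta> k) \<preceq> dens (upper_barrier p \<rho>0 \<delta> k) \<and>
        dens (lower_barrier p \<rho>0 \<delta> k) \<preceq> dens (lower_barrier p \<rho>0 (\<delta> / 2) (2 * k)) \<and>
        dens (upper_barrier p \<rho>0 (\<delta> / 2) (2 * k)) \<preceq> dens (upper_barrier p \<rho>0 \<delta> k)) \<and>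
     (\<exists>u. between_barriers p \<rho>0 u \<and>
        (\<forall>u'. between_barriers p \<rho>0 u' \<longrightarrow> (\<forall>t>0. AE r in lborel. u' r t = u r t))) \<and>
     (\<exists>c::real. \<forall>T>0. \<forall>n::nat. \<forall>\<delta>. \<delta> = T / 2 ^ n \<longrightarrow>
        (\<integral>\<^sup>+ r. ennreal \<bar>lower_barrier p \<rho>0 \<delta> (2 ^ n) r - upper_barrier p \<rho>0 \<delta> (2 ^ n) r\<bar>
           \<partial>lborel) \<le> ennreal (c * exp T * \<delta>))"
proof -
  note \<rho>0 = assms(2)
  \<comment> \<open>By translation invariance the starred jump density is the reflection of
    \<open>p 0\<close>, and reflection preserves the Lebesgue integral.\<close>
  have "pstar p 0 = (\<lambda>y. p 0 (- y))"
    by (rule ext) (simp add: pstar_def assms(6)[of _ 0])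
  moreover have "integrable lborel (\<lambda>y. p 0 (- y))" "(LINT y|lborel. p 0 (- y)) = 1"
    using mass_functionsD[OF assms(7)[of 0]] lborel_integrable_real_affine[of "p 0" "-1" 0]
      lborel_integral_real_affine[of "-1" "p 0" 0] by auto
  ultimately interpret jump_kernel p
    by unfold_locales (use mass_functionsD[OF assms(7)[of 0]] in \<open>auto simp: mass_functions_def\<close>)
  obtain M where M: "\<And>x. \<rho>0 x \<le> M"
    using smooth_bounded_support_le[OF assms(3,4)] by blast
  show ?thesis
  proof (intro conjI allI impI)
    fix \<delta> :: real and k :: nat
    assume "\<delta> > 0"
    then show "dens (lower_barrier p \<rho>0 \<delta> k) \<preceq> dens (upper_barrier p \<rho>0 \<delta> k)"
      "dens (lower_barrier p \<rho>0 \<delta> k) \<preceq> dens (lower_barrier p \<rho>0 (\<delta> / 2) (2 * k))"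
      "dens (upper_barrier p \<rho>0 (\<delta> / 2) (2 * k)) \<preceq> dens (upper_barrier p \<rho>0 \<delta> k)"
      using lower_le_upper[OF \<rho>0] lower_refine[OF \<rho>0, of \<delta> 2] upper_refine[OF \<rho>0, of \<delta> 2]
      by (simp_all add: tail_le_iff)
  next
    show "\<exists>u. between_barriers p \<rho>0 u \<and>
        (\<forall>u'. between_barriers p \<rho>0 u' \<longrightarrow> (\<forall>t>0. AE r in lborel. u' r t = u r t))"
      using between_barriers_exists[OF \<rho>0 M] between_barriers_unique[OF \<rho>0] by blast
  next
    show "\<exists>c::real. \<forall>T>0. \<forall>n::nat. \<forall>\<delta>. \<delta> = T / 2 ^ n \<longrightarrow>
        (\<integral>\<^sup>+ r. ennreal \<bar>lower_barrier p \<rho>0 \<delta> (2 ^ n) r - upper_barrier p \<rho>0 \<delta> (2 ^ n) r\<bar>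
           \<partial>lborel) \<le> ennreal (c * exp T * \<delta>)"
    proof (intro exI[of _ 4] allI impI)
      fix T \<delta> :: real and n :: nat
      assume "T > 0" "\<delta> = T / 2 ^ n"
      then show "(\<integral>\<^sup>+ r. ennreal \<bar>lower_barrier p \<rho>0 \<delta> (2 ^ n) r - upper_barrier p \<rho>0 \<delta> (2 ^ n) r\<bar>
           \<partial>lborel) \<le> ennreal (4 * exp T * \<delta>)"
        using nn_L1_barriers[OF \<rho>0, of \<delta> "2 ^ n"] by simp
    qed
  qed
qed

end
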